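(* Let $n\ge1$ be an integer, $\alpha\in(0,2]$ and $\nu>0$. The probability density function $p_{\alpha,\nu,n}$ has the representation $$p_{\alpha,\nu,n}(\mathbf{x})=q_{\alpha,\nu,n}(\Vert\mathbf{x}\Vert)=\frac{\alpha}{\Gamma(\nu)}\int_0^\infty u^{\alpha\nu-n-1}e^{-u^\alpha}\,\tilde{s}_{\alpha,n}\left(\frac{\Vert\mathbf{x}\Vert}{u}\right)du,\qquad \mathbf{x}\in\mathbb{R}^n\setminus\{\mathbf{0}\}.$$
   Context: $\Vert\cdot\Vert$ is the Euclidean norm on $\mathbb{R}^n$. For an integer $n\ge1$, $\alpha\in(0,2]$, $\nu>0$, $p_{\alpha,\nu,n}$ denotes the probability density function on $\mathbb{R}^n$ whose characteristic function is $\int_{\mathbb{R}^n}e^{i\mathbf{x}\cdot\boldsymbol{t}}p_{\alpha,\nu,n}(\mathbf{x})\,d^n\mathbf{x}=(1+\Vert\boldsymbol{t}\Vert^\alpha)^{-\nu}$ for all $\boldsymbol{t}\in\mathbb{R}^n$. It is a radial function; one takes the version which is continuous on $\mathbb{R}^n\setminus\{\mathbf{0}\}$, and $q_{\alpha,\nu,n}(r)$, $r>0$, denotes the value of $p_{\alpha,\nu,n}(\mathbf{x})$ at points with $\Vert\mathbf{x}\Vert=r$. $s_{\alpha,n}$ denotes the (continuous, radial) probability density function of the symmetric stable distribution with characteristic function $e^{-\Vert\boldsymbol{t}\Vert^\alpha}$, i.e. $s_{\alpha,n}(\mathbf{x})=\frac{1}{(2\pi)^n}\int_{\mathbb{R}^n}e^{-i\boldsymbol{t}\cdot\mathbf{x}}e^{-\Vert\boldsymbol{t}\Vert^\alpha}d^n\boldsymbol{t}$,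 and $\tilde{s}_{\alpha,n}(r)$ denotes the value of $s_{\alpha,n}(\mathbf{x})$ at points with $\Vert\mathbf{x}\Vert=r$. *)

theory Defs
  imports "HOL-Probability.Probability"
begin

text \<open>The library's \<open>char\<close> covers measures on the real line only, so the
  characteristic function of a density on a Euclidean space is written out here.\<close>

definition density_char :: "('a::euclidean_space \<Rightarrow> real) \<Rightarrow> 'a \<Rightarrow> complex" where
  "density_char p t = (LINT x|lborel. iexp (x \<bullet> t) * complex_of_real (p x))"

definition is_probability_density :: "('a::euclidean_space \<Rightarrow> real) \<Rightarrow> bool" where
  "is_probability_density p \<longleftrightarrow>
     p \<in> borel_measurable borel \<and> (\<forall>x. 0 \<le> p x) \<and>
     prob_space (density lborel (\<lambda>x. ennreal (p x)))"

text \<open>A version of the density \<open>p\<^sub>\<alpha>\<^sub>,\<^sub>\<nu>\<^sub>,\<^sub>n\<close>. These conditions determine \<open>p\<close> away from the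
  origin and leave its value at the origin open. Radial symmetry is not assumed; it
  is a consequence.\<close>

definition is_linnik_density :: "real \<Rightarrow> real \<Rightarrow> ('a::euclidean_space \<Rightarrow> real) \<Rightarrow> bool" where
  "is_linnik_density \<alpha> \<nu> p \<longleftrightarrow>
     is_probability_density p \<and>
     (\<forall>t. density_char p t = complex_of_real ((1 + norm t powr \<alpha>) powr (- \<nu>))) \<and>
     continuous_on (- {0}) p"

text \<open>The Fourier integral is real because the integrand at \<open>- t\<close> is the complex conjugate
  of the integrand at \<open>t\<close>; \<open>Re\<close> only changes the type.\<close>

definition stable_density :: "real \<Rightarrow> 'a::euclidean_space \<Rightarrow> real" where
  "stable_density \<alpha> x =
     Re (1 / complex_of_real ((2 * pi) ^ DIM('a)) *
         (LINT t|lborel. iexp (- (t \<bullet> x)) * complex_of_real (exp (- (norm t powr \<alpha>)))))"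

text \<open>The common value of \<open>f\<close> on the sphere of radius \<open>r \<ge> 0\<close>; unspecified if \<open>f\<close> is not
  constant on that sphere.\<close>

definition radial_profile :: "('a::euclidean_space \<Rightarrow> real) \<Rightarrow> real \<Rightarrow> real" where
  "radial_profile f r = (THE y. \<forall>x. norm x = r \<longrightarrow> f x = y)"

end

theory Submission
  imports Defs "HOL-Real_Asymp.Real_Asymp"
begin

text \<open>If \<open>G\<close> has a Gamma distribution with parameter \<open>\<nu>\<close> and \<open>S\<close> is stable and independent
  of \<open>G\<close>, then \<open>G powr (1/\<alpha>) * S\<close> has the characteristic function of \<open>p\<close>, and the right-hand side
  is the density of this product.

  That \<open>s\<close> is a probability density is read off from the existence of \<open>p\<close>:
  \<open>exp (- (norm t powr \<alpha>))\<close> is the limit of \<open>(1 + norm t powr \<alpha> / (m * \<nu>)) powr (- m * \<nu>)\<close>, the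
  characteristic functions of rescaled \<open>m\<close>-fold convolutions of \<open>p\<close>. Equality at every point
  \<open>x \<noteq> 0\<close>, not only almost everywhere, follows by Gaussian smoothing, which recovers a
  nonnegative integrable function from its characteristic function at each point of continuity.\<close>

section \<open>Gaussian integrals and Fourier inversion\<close>

text \<open>Nonnegativity of the stable density cannot be seen from its Fourier integral, yet the
  rest leans on it: it lets monotone convergence produce integrability of
  \<open>stable_density\<close>, and it turns the absolute values in Fubini's theorem for the
  mixture into a Gamma integral. The other obstacle is pointwise. Fubini makes the mixture integral
  converge for almost every point only and says nothing about continuity. Rotation invariance
  removes this: after \<open>u = norm x * v\<close> the stable factor no longer depends on
  \<open>x\<close>, and under the integral the radius survives only in
  \<open>exp (- ((norm x * v) powr \<alpha>))\<close>. This factor is decreasing and continuous in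
  the radius, which gives convergence and continuity off the origin without any estimate on the
  decay of the stable density.\<close>

lemma lborel_integral_affine:
  fixes f :: "'a::euclidean_space \<Rightarrow> 'b::{banach, second_countable_topology}"
  assumes [measurable]: "f \<in> borel_measurable borel" and "c \<noteq> 0"
  shows "integral\<^sup>L lborel f = \<bar>c\<bar> ^ DIM('a) *\<^sub>R (LINT x|lborel. f (t + c *\<^sub>R x))"
  by (subst lborel_affine[OF \<open>c \<noteq> 0\<close>, of t]) (simp add: integral_density integral_distr)

lemma lborel_integrable_affine:
  fixes f :: "'a::euclidean_space \<Rightarrow> 'b::{banach, second_countable_topology}"
  assumes f: "integrable lborel f" and "c \<noteq> 0"
  shows "integrable lborel (\<lambda>x. f (t + c *\<^sub>R x))"
proof -
  have [measurable]: "f \<in> borel_measurable borel"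
    using f by auto
  have "integrable (density (distr lborel borel (\<lambda>x. t + c *\<^sub>R x)) (\<lambda>_. ennreal (\<bar>c\<bar> ^ DIM('a)))) f"
    using f lborel_affine[OF \<open>c \<noteq> 0\<close>, of t] by simp
  then have "integrable lborel (\<lambda>x. (\<bar>c\<bar> ^ DIM('a)) *\<^sub>R f (t + c *\<^sub>R x))"
    by (simp add: integrable_density integrable_distr_eq)
  then have "integrable lborel (\<lambda>x. inverse (\<bar>c\<bar> ^ DIM('a)) *\<^sub>R (\<bar>c\<bar> ^ DIM('a)) *\<^sub>R f (t + c *\<^sub>R x))"
    by (rule integrable_scaleR_right)
  then show ?thesis
    using \<open>c \<noteq> 0\<close> by simp
qed

lemma std_gaussian_fourier_real:
  fixes x :: real
  shows "integrable lborel (\<lambda>t. iexp (t * x) * complex_of_real (exp (- (t\<^sup>2) / 2)))"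
    and "(LINT t|lborel. iexp (t * x) * complex_of_real (exp (- (t\<^sup>2) / 2)))
      = complex_of_real (sqrt (2 * pi) * exp (- (x\<^sup>2) / 2))"
proof -
  have eq: "iexp (t * x) * complex_of_real (exp (- (t\<^sup>2) / 2))
    = complex_of_real (sqrt (2 * pi)) * (std_normal_density t *\<^sub>R iexp (x * t))" for t
    by (simp add: std_normal_density_def scaleR_conv_of_real mult.commute)
  have int: "integrable lborel (\<lambda>t. std_normal_density t *\<^sub>R iexp (x * t))"
    by (rule Bochner_Integration.integrable_bound[OF integrable_normal_density[of 1 0]]) auto
  show "integrable lborel (\<lambda>t. iexp (t * x) * complex_of_real (exp (- (t\<^sup>2) / 2)))"
    using int unfolding eq by (rule integrable_mult_right)
  have "(LINT t|lborel. std_normal_density t *\<^sub>R iexp (x * t)) = char std_normal_distribution x"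
    unfolding char_def by (subst integral_density) auto
  then show "(LINT t|lborel. iexp (t * x) * complex_of_real (exp (- (t\<^sup>2) / 2)))
      = complex_of_real (sqrt (2 * pi) * exp (- (x\<^sup>2) / 2))"
    unfolding eq integral_mult_right_zero by (simp add: char_std_normal_distribution)
qed

lemma
  fixes f :: "'a::euclidean_space \<Rightarrow> real \<Rightarrow> 'b::{real_normed_field, banach, second_countable_topology}"
  assumes f: "\<And>b. b \<in> Basis \<Longrightarrow> integrable lborel (f b)"
  shows lborel_integrable_prod: "integrable lborel (\<lambda>x. \<Prod>b\<in>Basis. f b (x \<bullet> b))"
    and lborel_integral_prod:
      "(LINT x|lborel. (\<Prod>b\<in>Basis. f b (x \<bullet> b))) = (\<Prod>b\<in>Basis. integral\<^sup>L lborel (f b))"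
proof -
  interpret product_sigma_finite "\<lambda>_::'a. lborel :: real measure" ..
  have [measurable]: "b \<in> Basis \<Longrightarrow> f b \<in> borel_measurable borel" for b
    using f by fastforce
  have eq: "(\<Prod>b\<in>Basis. f b ((\<Sum>c\<in>Basis. y c *\<^sub>R c) \<bullet> b)) = (\<Prod>b\<in>Basis. f b (y b))" for y
    by (intro prod.cong) auto
  show "integrable lborel (\<lambda>x. \<Prod>b\<in>Basis. f b (x \<bullet> b))"
    using product_integrable_prod[of Basis f] f
    by (subst lborel_eq) (simp add: integrable_distr_eq eq)
  show "(LINT x|lborel. (\<Prod>b\<in>Basis. f b (x \<bullet> b))) = (\<Prod>b\<in>Basis. integral\<^sup>L lborel (f b))"
    using product_integral_prod[of Basis f] f
    by (subst lborel_eq) (simp add: integral_distr eq)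
qed

text \<open>Both the Gaussian and the exponential factor over the coordinates, so the claim is a
  product of one-dimensional normal characteristic functions.\<close>

lemma std_gaussian_fourier:
  fixes x :: "'a::euclidean_space"
  shows "integrable lborel (\<lambda>t. iexp (t \<bullet> x) * complex_of_real (exp (- (norm t)\<^sup>2 / 2)))"
    and "(LINT t|lborel. iexp (t \<bullet> x) * complex_of_real (exp (- (norm t)\<^sup>2 / 2)))
      = complex_of_real (sqrt (2 * pi) ^ DIM('a) * exp (- (norm x)\<^sup>2 / 2))"
proof -
  define f where "f b s = iexp (s * (x \<bullet> b)) * complex_of_real (exp (- (s\<^sup>2) / 2))" for b :: 'a and s
  have nrm: "- (norm t)\<^sup>2 / 2 = (\<Sum>b\<in>Basis. - ((t \<bullet> b)\<^sup>2) / 2)" for t :: 'a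
    unfolding power2_norm_eq_inner euclidean_inner[of t t]
    by (simp add: sum_divide_distrib power2_eq_square sum_negf)
  have eq: "iexp (t \<bullet> x) * complex_of_real (exp (- (norm t)\<^sup>2 / 2)) = (\<Prod>b\<in>Basis. f b (t \<bullet> b))" for t
    unfolding nrm f_def prod.distrib
    by (simp add: exp_sum euclidean_inner[of t x] sum_distrib_left flip: of_real_prod exp_sum)
  show "integrable lborel (\<lambda>t. iexp (t \<bullet> x) * complex_of_real (exp (- (norm t)\<^sup>2 / 2)))"
    unfolding eq by (intro lborel_integrable_prod) (unfold f_def, rule std_gaussian_fourier_real)
  have "(LINT t|lborel. iexp (t \<bullet> x) * complex_of_real (exp (- (norm t)\<^sup>2 / 2)))
     = (\<Prod>b\<in>Basis. integral\<^sup>L lborel (f b))"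
    unfolding eq by (intro lborel_integral_prod) (unfold f_def, rule std_gaussian_fourier_real)
  also have "\<dots> = complex_of_real (\<Prod>b\<in>Basis. sqrt (2 * pi) * exp (- ((x \<bullet> b)\<^sup>2) / 2))"
    unfolding f_def std_gaussian_fourier_real(2) by simp
  also have "\<dots> = complex_of_real (sqrt (2 * pi) ^ DIM('a) * exp (- (norm x)\<^sup>2 / 2))"
    unfolding nrm by (simp add: prod.distrib exp_sum)
  finally show "(LINT t|lborel. iexp (t \<bullet> x) * complex_of_real (exp (- (norm t)\<^sup>2 / 2)))
      = complex_of_real (sqrt (2 * pi) ^ DIM('a) * exp (- (norm x)\<^sup>2 / 2))" .
qed

lemma gaussian_fourier:
  fixes x :: "'a::euclidean_space"
  assumes "0 < \<sigma>"
  shows "integrable lborel (\<lambda>t. iexp (t \<bullet> x) * complex_of_real (exp (- (norm (\<sigma> *\<^sub>R t))\<^sup>2 / 2)))"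
    and "(LINT t|lborel. iexp (t \<bullet> x) * complex_of_real (exp (- (norm (\<sigma> *\<^sub>R t))\<^sup>2 / 2)))
      = complex_of_real ((sqrt (2 * pi) / \<sigma>) ^ DIM('a) * exp (- (norm (x /\<^sub>R \<sigma>))\<^sup>2 / 2))"
proof -
  let ?f = "\<lambda>t::'a. iexp (t \<bullet> (x /\<^sub>R \<sigma>)) * complex_of_real (exp (- (norm t)\<^sup>2 / 2))"
  have eq: "?f (0 + \<sigma> *\<^sub>R t) = iexp (t \<bullet> x) * complex_of_real (exp (- (norm (\<sigma> *\<^sub>R t))\<^sup>2 / 2))" for t
    using assms by (simp add: field_simps)
  show "integrable lborel (\<lambda>t. iexp (t \<bullet> x) * complex_of_real (exp (- (norm (\<sigma> *\<^sub>R t))\<^sup>2 / 2)))"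
    using lborel_integrable_affine[OF std_gaussian_fourier(1)[of "x /\<^sub>R \<sigma>"], of \<sigma> 0] assms
    unfolding eq by simp
  have "integral\<^sup>L lborel ?f = \<bar>\<sigma>\<bar> ^ DIM('a) *\<^sub>R
      (LINT t|lborel. iexp (t \<bullet> x) * complex_of_real (exp (- (norm (\<sigma> *\<^sub>R t))\<^sup>2 / 2)))"
    using lborel_integral_affine[of ?f \<sigma> 0] assms unfolding eq by simp
  then show "(LINT t|lborel. iexp (t \<bullet> x) * complex_of_real (exp (- (norm (\<sigma> *\<^sub>R t))\<^sup>2 / 2)))
      = complex_of_real ((sqrt (2 * pi) / \<sigma>) ^ DIM('a) * exp (- (norm (x /\<^sub>R \<sigma>))\<^sup>2 / 2))"
    using assms unfolding std_gaussian_fourier(2)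
    by (simp add: scaleR_conv_of_real field_simps power_divide)
qed

lemma integrable_gaussian:
  assumes "0 < \<sigma>"
  shows "integrable lborel (\<lambda>t::'a::euclidean_space. exp (- (norm (\<sigma> *\<^sub>R t))\<^sup>2 / 2))"
  using gaussian_fourier(1)[OF assms, of "0::'a"] by (simp add: complex_of_real_integrable_eq)

text \<open>The Gaussian dominates the integrand on the product with the finite measure
  \<open>M\<close>, so Fubini applies, and the inner integral over \<open>t\<close> is the Gaussian
  transform at \<open>y - x\<close>. One side depends on \<open>M\<close> only through its
  characteristic function; the other is visibly nonnegative and concentrates near \<open>x\<close>
  as \<open>\<sigma>\<close> shrinks.\<close>

lemma gaussian_smoothing:
  fixes M :: "'a::euclidean_space measure"
  assumes "finite_measure M" and sets_M: "sets M = sets borel" and "0 < \<sigma>"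
  shows "(LINT t|lborel. iexp (- (t \<bullet> x)) * (LINT y|M. iexp (y \<bullet> t)) *
        complex_of_real (exp (- (norm (\<sigma> *\<^sub>R t))\<^sup>2 / 2)))
    = complex_of_real (LINT y|M. (sqrt (2 * pi) / \<sigma>) ^ DIM('a) * exp (- (norm ((y - x) /\<^sub>R \<sigma>))\<^sup>2 / 2))"
proof -
  interpret M: finite_measure M by fact
  note [measurable_cong] = sets_M
  interpret P: pair_sigma_finite M "lborel :: 'a measure" ..
  let ?G = "\<lambda>t::'a. exp (- (norm (\<sigma> *\<^sub>R t))\<^sup>2 / 2)"
  define F where "F y t = iexp (t \<bullet> (y - x)) * complex_of_real (?G t)" for y t
  have nF: "norm (F y t) = ?G t" for y t
    by (simp add: F_def norm_mult)
  have eq: "iexp (- (t \<bullet> x)) * iexp (y \<bullet> t) * complex_of_real (?G t) = F y t" for y t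
    by (simp add: F_def inner_diff_right inner_commute[of y] exp_diff exp_minus field_simps)
  have "integrable (M \<Otimes>\<^sub>M lborel) (case_prod F)"
  proof (rule P.Fubini_integrable)
    show "case_prod F \<in> borel_measurable (M \<Otimes>\<^sub>M lborel)"
      unfolding F_def by measurable
    show "AE y in M. integrable lborel (\<lambda>t. case_prod F (y, t))"
      unfolding F_def prod.case using gaussian_fourier(1)[OF \<open>0 < \<sigma>\<close>] by (intro AE_I2)
  qed (simp add: nF)
  then have "(LINT t|lborel. (LINT y|M. F y t)) = (LINT y|M. (LINT t|lborel. F y t))"
    by (rule P.Fubini_integral)
  moreover have "(LINT y|M. F y t) = iexp (- (t \<bullet> x)) * (LINT y|M. iexp (y \<bullet> t)) * complex_of_real (?G t)" for t
    by (simp add: eq[symmetric])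
  moreover have "(LINT t|lborel. F y t)
      = complex_of_real ((sqrt (2 * pi) / \<sigma>) ^ DIM('a) * exp (- (norm ((y - x) /\<^sub>R \<sigma>))\<^sup>2 / 2))" for y
    unfolding F_def by (rule gaussian_fourier(2)[OF \<open>0 < \<sigma>\<close>])
  ultimately show ?thesis
    by simp
qed

lemma std_gaussian_integral:
  shows "integrable lborel (\<lambda>t::'a::euclidean_space. exp (- (norm t)\<^sup>2 / 2))"
    and "(LINT t|lborel. exp (- (norm (t::'a::euclidean_space))\<^sup>2 / 2)) = sqrt (2 * pi) ^ DIM('a)"
proof -
  show int: "integrable lborel (\<lambda>t::'a. exp (- (norm t)\<^sup>2 / 2))"
    using integrable_gaussian[of 1] by simp
  show "(LINT t|lborel. exp (- (norm (t::'a))\<^sup>2 / 2)) = sqrt (2 * pi) ^ DIM('a)"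
    using std_gaussian_fourier(2)[of "0::'a"]
    by (simp add: integral_complex_of_real del: of_real_power flip: of_real_exp)
qed

text \<open>Since \<open>f\<close> may be unbounded away from \<open>x\<close>, no single majorant
  serves all \<open>z\<close>. The split radius \<open>\<delta> * Suc k\<close> is the one at which
  the argument of \<open>f\<close> leaves the \<open>\<delta>\<close>-ball around \<open>x\<close>.
  Inside it, \<open>f x + 1\<close> bounds \<open>f\<close> and dominated convergence applies.
  Outside it, the Gaussian is bounded by its value at the split radius; integrating \<open>f\<close>
  then costs the Jacobian \<open>Suc k ^ DIM('a)\<close>, which the exponential beats.\<close>

lemma gaussian_average_tendsto:
  fixes f :: "'a::euclidean_space \<Rightarrow> real"
  assumes f: "integrable lborel f" and nonneg: "\<And>y. 0 \<le> f y" and cont: "isCont f x"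
  shows "(\<lambda>k. LINT z|lborel. f (x + (1 / Suc k) *\<^sub>R z) * exp (- (norm z)\<^sup>2 / 2))
    \<longlonglongrightarrow> sqrt (2 * pi) ^ DIM('a) * f x"
proof -
  let ?G = "\<lambda>z::'a. exp (- (norm z)\<^sup>2 / 2)"
  have [measurable]: "f \<in> borel_measurable borel" using f by auto
  have [measurable]: "ball (0::'a) r \<in> sets borel" for r by simp
  obtain \<delta> where "0 < \<delta>" and \<delta>: "\<And>y. dist y x < \<delta> \<Longrightarrow> f y \<le> f x + 1"
  proof -
    obtain d where "0 < d" "\<And>y. dist y x < d \<Longrightarrow> dist (f y) (f x) < 1"
      using cont unfolding continuous_at_eps_delta by (metis zero_less_one)
    then show ?thesis
      by (intro that[of d]) (auto simp: dist_real_def abs_less_iff intro: less_imp_le, smt (verit))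
  qed
  define near where "near k z = f (x + (1 / Suc k) *\<^sub>R z) * ?G z * indicator (ball 0 (\<delta> * Suc k)) z" for k z
  define far where "far k z = f (x + (1 / Suc k) *\<^sub>R z) * ?G z * indicator (- ball 0 (\<delta> * Suc k)) z" for k z
  have small: "f (x + (1 / Suc k) *\<^sub>R z) \<le> f x + 1" if "z \<in> ball 0 (\<delta> * Suc k)" for k z
    using that by (intro \<delta>) (simp add: dist_norm field_simps)
  have shift_int: "integrable lborel (\<lambda>z. f (x + (1 / Suc k) *\<^sub>R z))" for k
    using f by (intro lborel_integrable_affine) auto
  have G_le: "?G z \<le> exp (- (\<delta> * Suc k)\<^sup>2 / 2)" if "z \<notin> ball 0 (\<delta> * Suc k)" for z k
    using that \<open>0 < \<delta>\<close> by (simp add: power_mono)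
  have far_le: "far k z \<le> exp (- (\<delta> * Suc k)\<^sup>2 / 2) * f (x + (1 / Suc k) *\<^sub>R z)" for k z
    using mult_left_mono[OF G_le nonneg] nonneg by (auto simp: far_def indicator_def mult.commute)
  have far_nonneg: "0 \<le> far k z" for k z
    using nonneg by (simp add: far_def)
  have far_int: "integrable lborel (far k)" for k
    by (rule Bochner_Integration.integrable_bound[OF integrable_mult_right[OF shift_int[of k], of "exp (- (\<delta> * Suc k)\<^sup>2 / 2)"]])
      (use far_le far_nonneg nonneg in \<open>auto simp: far_def[abs_def]\<close>)
  have near_bound: "norm (near k z) \<le> (f x + 1) * ?G z" for k z
    using mult_right_mono[OF small[of z k], of "?G z"] nonneg by (auto simp: near_def indicator_def)
  have dom: "integrable lborel (\<lambda>z. (f x + 1) * ?G z)"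
    by (intro integrable_mult_right std_gaussian_integral)
  have [measurable]: "near k \<in> borel_measurable borel" for k
    unfolding near_def by measurable
  have near_int: "integrable lborel (near k)" for k
  proof (rule Bochner_Integration.integrable_bound[OF dom])
    show "AE z in lborel. norm (near k z) \<le> norm ((f x + 1) * ?G z)"
      using order_trans[OF near_bound abs_ge_self] by (intro AE_I2) (simp only: real_norm_def)
  qed simp
  have near_lim: "(\<lambda>k. integral\<^sup>L lborel (near k)) \<longlonglongrightarrow> (LINT z|lborel. f x * ?G z)"
  proof (rule integral_dominated_convergence[OF _ _ dom])
    show "AE z in lborel. (\<lambda>k. near k z) \<longlonglongrightarrow> f x * ?G z"
    proof (rule AE_I2)
      fix z :: 'a
      have "(\<lambda>k. x + (1 / Suc k) *\<^sub>R z) \<longlonglongrightarrow> x"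
        using tendsto_add[OF tendsto_const tendsto_scaleR[OF LIMSEQ_Suc[OF lim_1_over_n] tendsto_const]]
        by (force simp: divide_inverse)
      then have "(\<lambda>k. f (x + (1 / Suc k) *\<^sub>R z) * ?G z) \<longlonglongrightarrow> f x * ?G z"
        by (intro tendsto_mult tendsto_const isCont_tendsto_compose[OF cont])
      moreover have "eventually (\<lambda>k. norm z < \<delta> * Suc k) sequentially"
        using \<open>0 < \<delta>\<close> by real_asymp
      then have "eventually (\<lambda>k. f (x + (1 / Suc k) *\<^sub>R z) * ?G z = near k z) sequentially"
        by eventually_elim (simp add: near_def)
      ultimately show "(\<lambda>k. near k z) \<longlonglongrightarrow> f x * ?G z"
        by (rule Lim_transform_eventually)
    qed
  qed (simp_all only: near_bound AE_I2, simp_all)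
  have far_lim: "(\<lambda>k. integral\<^sup>L lborel (far k)) \<longlonglongrightarrow> 0"
  proof (rule tendsto_sandwich[OF _ _ tendsto_const])
    show "eventually (\<lambda>k. 0 \<le> integral\<^sup>L lborel (far k)) sequentially"
      using far_nonneg by simp
    have "integral\<^sup>L lborel (far k) \<le> integral\<^sup>L lborel f * (real (Suc k) ^ DIM('a) * exp (- (\<delta> * Suc k)\<^sup>2 / 2))" for k
    proof -
      have "integral\<^sup>L lborel (far k) \<le> exp (- (\<delta> * Suc k)\<^sup>2 / 2) * (LINT z|lborel. f (x + (1 / Suc k) *\<^sub>R z))"
        using far_le by (subst integral_mult_right_zero[symmetric], intro integral_mono far_int integrable_mult_right shift_int) auto
      also have "(LINT z|lborel. f (x + (1 / Suc k) *\<^sub>R z)) = real (Suc k) ^ DIM('a) * integral\<^sup>L lborel f"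
        by (subst lborel_integral_affine[of f "1 / Suc k" x]) (simp_all add: power_one_over)
      finally show ?thesis by (simp add: algebra_simps)
    qed
    then show "eventually (\<lambda>k. integral\<^sup>L lborel (far k) \<le> integral\<^sup>L lborel f * (real (Suc k) ^ DIM('a) * exp (- (\<delta> * Suc k)\<^sup>2 / 2))) sequentially"
      by simp
    have "(\<lambda>k. real (Suc k) ^ DIM('a) * exp (- (\<delta> * Suc k)\<^sup>2 / 2)) \<longlonglongrightarrow> 0"
      using \<open>0 < \<delta>\<close> by real_asymp
    then show "(\<lambda>k. integral\<^sup>L lborel f * (real (Suc k) ^ DIM('a) * exp (- (\<delta> * Suc k)\<^sup>2 / 2))) \<longlonglongrightarrow> 0"
      by (rule tendsto_mult_right_zero)
  qed
  have "(LINT z|lborel. f (x + (1 / Suc k) *\<^sub>R z) * ?G z) = integral\<^sup>L lborel (near k) + integral\<^sup>L lborel (far k)" for k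
    by (subst Bochner_Integration.integral_add[OF near_int far_int, symmetric], rule Bochner_Integration.integral_cong)
      (auto simp: near_def far_def indicator_def)
  with tendsto_add[OF near_lim far_lim] show ?thesis
    unfolding integral_mult_right_zero std_gaussian_integral(2) by (simp add: mult.commute[of "f x"])
qed

text \<open>Smoothing with \<sigma> = 1 / (k + 1) and substituting
  \<open>y = x + z / (k + 1)\<close> turns the integral into the Gaussian average of
  \<open>f\<close> around \<open>x\<close>. One factor \<open>sqrt (2 * pi) ^ DIM('a)\<close> comes
  from the Gaussian transform, the other from the total Gaussian mass. Consequently
  \<open>density_char f\<close> determines \<open>f\<close> wherever \<open>f\<close> is
  continuous.\<close>

lemma fourier_inversion_smoothed:
  fixes f :: "'a::euclidean_space \<Rightarrow> real"
  assumes f: "integrable lborel f" and nonneg: "\<And>y. 0 \<le> f y" and cont: "isCont f x"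
  shows "(\<lambda>k. LINT t|lborel. iexp (- (t \<bullet> x)) * density_char f t *
        complex_of_real (exp (- (norm ((1 / Suc k) *\<^sub>R t))\<^sup>2 / 2)))
    \<longlonglongrightarrow> complex_of_real ((2 * pi) ^ DIM('a) * f x)"
proof -
  have [measurable]: "f \<in> borel_measurable borel" using f by auto
  define M where "M = density lborel (\<lambda>y. ennreal (f y))"
  have M: "finite_measure M"
    using f nonneg by (intro finite_measureI) (auto simp: M_def emeasure_density nn_integral_eq_integral)
  have char: "(LINT y|M. iexp (y \<bullet> t)) = density_char f t" for t
    unfolding M_def density_char_def using nonneg
    by (subst integral_density) (auto simp: scaleR_conv_of_real mult.commute)
  have "(LINT t|lborel. iexp (- (t \<bullet> x)) * density_char f t * complex_of_real (exp (- (norm ((1 / Suc k) *\<^sub>R t))\<^sup>2 / 2)))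
    = complex_of_real (sqrt (2 * pi) ^ DIM('a) * (LINT z|lborel. f (x + (1 / Suc k) *\<^sub>R z) * exp (- (norm z)\<^sup>2 / 2)))" for k
  proof -
    let ?c = "1 / Suc k"
    have "(LINT t|lborel. iexp (- (t \<bullet> x)) * density_char f t * complex_of_real (exp (- (norm (?c *\<^sub>R t))\<^sup>2 / 2)))
      = complex_of_real (LINT y|M. (sqrt (2 * pi) / ?c) ^ DIM('a) * exp (- (norm ((y - x) /\<^sub>R ?c))\<^sup>2 / 2))"
      unfolding char[symmetric] by (rule gaussian_smoothing[OF M]) (auto simp: M_def)
    also have "(LINT y|M. (sqrt (2 * pi) / ?c) ^ DIM('a) * exp (- (norm ((y - x) /\<^sub>R ?c))\<^sup>2 / 2))
      = (sqrt (2 * pi) / ?c) ^ DIM('a) * (LINT y|lborel. f y * exp (- (norm ((y - x) /\<^sub>R ?c))\<^sup>2 / 2))"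
      unfolding M_def integral_mult_right_zero using nonneg by (subst integral_density) auto
    also have "(LINT y|lborel. f y * exp (- (norm ((y - x) /\<^sub>R ?c))\<^sup>2 / 2))
      = ?c ^ DIM('a) * (LINT z|lborel. f (x + ?c *\<^sub>R z) * exp (- (norm z)\<^sup>2 / 2))"
      by (subst lborel_integral_affine[of _ ?c x]) auto
    also have "(sqrt (2 * pi) / ?c) ^ DIM('a) * (?c ^ DIM('a) * (LINT z|lborel. f (x + ?c *\<^sub>R z) * exp (- (norm z)\<^sup>2 / 2)))
      = sqrt (2 * pi) ^ DIM('a) * (LINT z|lborel. f (x + ?c *\<^sub>R z) * exp (- (norm z)\<^sup>2 / 2))"
      unfolding power_divide by simp
    finally show ?thesis .
  qed
  moreover have "(\<lambda>k. sqrt (2 * pi) ^ DIM('a) * (LINT z|lborel. f (x + (1 / Suc k) *\<^sub>R z) * exp (- (norm z)\<^sup>2 / 2)))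
    \<longlonglongrightarrow> sqrt (2 * pi) ^ DIM('a) * (sqrt (2 * pi) ^ DIM('a) * f x)"
    by (intro tendsto_mult tendsto_const gaussian_average_tendsto assms)
  moreover have "sqrt (2 * pi) ^ DIM('a) * (sqrt (2 * pi) ^ DIM('a) * f x) = (2 * pi) ^ DIM('a) * f x"
    unfolding mult.assoc[symmetric] power_mult_distrib[symmetric] by simp
  ultimately show ?thesis
    by (simp only: tendsto_of_real_iff)
qed

section \<open>Rotation invariance\<close>

lemma translation_invariant_eq_lborel:
  fixes N :: "'a::euclidean_space measure"
  assumes sets_N: "sets N = sets borel"
    and translate: "\<And>a. distr N borel (\<lambda>x. x + a) = N"
    and ball: "emeasure N (ball 0 1) = emeasure lborel (ball (0::'a) 1)"
    and "sigma_finite_measure N"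
  shows "N = lborel"
proof (rule measure_eqI)
  show "sets N = sets lborel" by (simp add: sets_N)
next
  fix A assume "A \<in> sets N"
  then have A[measurable]: "A \<in> sets borel" by (simp add: sets_N)
  note [measurable_cong] = sets_N
  interpret N: sigma_finite_measure N by fact
  interpret P: pair_sigma_finite N "lborel :: 'a measure" ..
  let ?B = "ball (0::'a) 1"
  have [measurable]: "?B \<in> sets borel" by simp
  have tr: "(\<integral>\<^sup>+x. h (x + a) \<partial>N) = integral\<^sup>N N h" if [measurable]: "h \<in> borel_measurable borel" for h a
    by (subst (2) translate[of a, symmetric], subst nn_integral_distr) auto
  have trl: "(\<integral>\<^sup>+y. h (x + y) \<partial>lborel) = integral\<^sup>N lborel h"
    and refl: "(\<integral>\<^sup>+y. h (x - y) \<partial>lborel) = integral\<^sup>N lborel h"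
    if [measurable]: "h \<in> borel_measurable borel" for h :: "'a \<Rightarrow> ennreal" and x
    by (subst (2) lborel_affine[of 1 x], simp, simp add: nn_integral_density nn_integral_distr)
       (subst (2) lborel_affine[of "-1" x], simp, simp add: nn_integral_density nn_integral_distr)
  \<comment> \<open>Uniqueness of Haar measure: integrate \<open>indicator A x * indicator ?B (x + y)\<close> in both orders,
    translating by \<open>y\<close> in between.\<close>
  have "emeasure N A * emeasure lborel ?B = (\<integral>\<^sup>+x. indicator A x * (\<integral>\<^sup>+y. indicator ?B (x + y) \<partial>lborel) \<partial>N)"
    by (subst trl) (auto simp: nn_integral_multc intro!: borel_measurable_indicator)
  also have "\<dots> = (\<integral>\<^sup>+x. (\<integral>\<^sup>+y. indicator A x * indicator ?B (x + y) \<partial>lborel) \<partial>N)"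
    by (simp add: nn_integral_cmult)
  also have "\<dots> = (\<integral>\<^sup>+y. (\<integral>\<^sup>+x. indicator A x * indicator ?B (x + y) \<partial>N) \<partial>lborel)"
    by (rule P.Fubini'[symmetric]) measurable
  also have "\<dots> = (\<integral>\<^sup>+y. (\<integral>\<^sup>+x. indicator A (x - y) * indicator ?B x \<partial>N) \<partial>lborel)"
  proof (rule nn_integral_cong)
    fix y :: 'a
    show "(\<integral>\<^sup>+x. indicator A x * indicator ?B (x + y) \<partial>N) = (\<integral>\<^sup>+x. indicator A (x - y) * indicator ?B x \<partial>N)"
      using tr[of "\<lambda>x. indicator A (x - y) * indicator ?B x" y] by simp
  qed
  also have "\<dots> = (\<integral>\<^sup>+x. (\<integral>\<^sup>+y. indicator A (x - y) * indicator ?B x \<partial>lborel) \<partial>N)"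
    by (rule P.Fubini') measurable
  also have "\<dots> = (\<integral>\<^sup>+x. (\<integral>\<^sup>+y. indicator A (x - y) \<partial>lborel) * indicator ?B x \<partial>N)"
    by (simp add: nn_integral_multc)
  also have "\<dots> = emeasure lborel A * emeasure N ?B"
    by (subst refl) (auto simp: nn_integral_cmult)
  finally have "emeasure lborel ?B * emeasure N A = emeasure lborel ?B * emeasure lborel A"
    by (simp add: ball mult.commute)
  moreover have "emeasure lborel ?B \<noteq> 0" "emeasure lborel ?B \<noteq> \<infinity>"
    using emeasure_lborel_ball_finite[of "0::'a" 1] content_ball_pos[of 1 "0::'a"]
    by (auto simp: measure_def)
  ultimately show "emeasure N A = emeasure lborel A"
    by (simp add: ennreal_mult_cancel_left)
qed

text \<open>Uniqueness of the translation-invariant measure takes the place of a determinant. By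
  surjectivity a translation by \<open>a\<close> behind \<open>f\<close> is a translation by a
  preimage of \<open>a\<close> before it; balls around the origin are their own preimages, which
  gives the normalisation and sigma-finiteness.\<close>

lemma distr_lborel_orthogonal:
  fixes f :: "real ^ 'n \<Rightarrow> real ^ 'n"
  assumes f: "orthogonal_transformation f"
  shows "distr lborel borel f = lborel"
proof (rule translation_invariant_eq_lborel)
  have lin: "linear f" and iso: "\<And>x. norm (f x) = norm x"
    using f by (auto simp: orthogonal_transformation)
  have [measurable]: "f \<in> borel_measurable borel"
    using lin by (intro borel_measurable_continuous_onI linear_continuous_on) (simp add: linear_conv_bounded_linear)
  have bij: "bij f" using f by (rule orthogonal_transformation_bij)
  show "sets (distr lborel borel f) = sets borel" by simp
  show "distr (distr lborel borel f) borel (\<lambda>x. x + a) = distr lborel borel f" for a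
  proof -
    obtain b where b: "f b = a" using bij by (metis bij_pointE)
    have *: "distr lborel borel (\<lambda>x. b + x) = (lborel :: (real^'n) measure)"
      using lborel_affine[of 1 b] by (simp add: density_1)
    have "distr (distr lborel borel f) borel (\<lambda>x. x + a) = distr (distr lborel borel (\<lambda>x. b + x)) borel f"
      using lin b by (simp add: distr_distr o_def linear_add add.commute)
    then show ?thesis by (simp add: *)
  qed
  have vim: "f -` ball 0 r = ball 0 r" for r
    using iso by auto
  show "emeasure (distr lborel borel f) (ball 0 1) = emeasure lborel (ball (0::real^'n) 1)"
    by (simp add: emeasure_distr vim)
  show "sigma_finite_measure (distr lborel borel f)"
  proof
    show "\<exists>A. countable A \<and> A \<subseteq> sets (distr lborel borel f) \<and> \<Union> A = space (distr lborel borel f) \<and>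
      (\<forall>a\<in>A. emeasure (distr lborel borel f) a \<noteq> \<infinity>)"
    proof (intro exI[of _ "range (\<lambda>n::nat. ball 0 (real n))"] conjI ballI)
      show "\<Union> (range (\<lambda>n::nat. ball (0::real^'n) (real n))) = space (distr lborel borel f)"
        by (auto simp: reals_Archimedean2)
      show "emeasure (distr lborel borel f) a \<noteq> \<infinity>" if "a \<in> range (\<lambda>n::nat. ball 0 (real n))" for a
        using that emeasure_lborel_ball_finite[of "0::real^'n"] by (auto simp: emeasure_distr vim less_top)
    qed auto
  qed
qed

section \<open>The symmetric stable density\<close>

text \<open>Writing the exponential as an integral over levels \<open>v\<close> lets Tonelli reduce
  an integral over the space to volumes of sublevel sets.\<close>

lemma exp_neg_layer_cake:
  assumes "0 \<le> (a::real)"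
  shows "(\<integral>\<^sup>+v. ennreal (exp (- v)) * indicator {a..} v \<partial>lborel) = ennreal (exp (- a))"
proof -
  have "(\<integral>\<^sup>+v. ennreal (exp (- v)) * indicator {a..} v \<partial>lborel) = ennreal (0 - (- exp (- a)))"
  proof (rule nn_integral_FTC_atLeast)
    show "((\<lambda>v. - exp (- v)) \<longlongrightarrow> 0) (at_top :: real filter)"
      by real_asymp
  qed (auto intro!: derivative_eq_intros)
  then show ?thesis by simp
qed

text \<open>By layers, only the volume of \<open>norm t powr \<alpha> \<le> v\<close> matters. It is
  empty for negative \<open>v\<close> and otherwise a ball of radius
  \<open>v powr (1 / \<alpha>)\<close>, whose volume grows polynomially in \<open>v\<close> and is
  absorbed by \<open>exp (- v)\<close>.\<close>

lemma integrable_exp_neg_norm_powr: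
  assumes "0 < \<alpha>"
  shows "integrable lborel (\<lambda>t::'a::euclidean_space. exp (- (norm t powr \<alpha>)))"
proof (rule integrableI_nonneg)
  interpret lborel_pair: pair_sigma_finite "lborel :: 'a measure" "lborel :: real measure" ..
  \<comment> \<open>The volume grows like \<open>v powr (DIM('a) / \<alpha>)\<close>; rounding the
    exponent up gives an integer moment of the exponential law, which is a factorial. The summand 1
    in the bound covers \<open>v \<le> 1\<close>, where rounding up would go the wrong way.\<close>
  define m where "m = nat \<lceil>DIM('a) / \<alpha>\<rceil>"
  let ?c = "unit_ball_vol (DIM('a))"
  have vol: "(\<integral>\<^sup>+t. indicator {norm (t::'a) powr \<alpha>..} v \<partial>lborel) \<le> ennreal (?c * (1 + v ^ m)) * indicator {0..} v" for v :: real
  proof (cases "0 \<le> v")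
    case True
    have "norm t \<le> v powr (1 / \<alpha>)" if "norm t powr \<alpha> \<le> v" for t :: 'a
      using powr_mono2[OF _ _ that, of "1 / \<alpha>"] assms by (simp add: powr_powr)
    then have "(\<integral>\<^sup>+t. indicator {norm (t::'a) powr \<alpha>..} v \<partial>lborel) \<le> (\<integral>\<^sup>+t. indicator (cball (0::'a) (v powr (1 / \<alpha>))) t \<partial>lborel)"
      by (intro nn_integral_mono) (auto simp: indicator_def)
    also have "\<dots> = ennreal (?c * (v powr (1 / \<alpha>)) ^ DIM('a))"
      by (simp add: emeasure_cball)
    also have "(v powr (1 / \<alpha>)) ^ DIM('a) \<le> 1 + v ^ m"
    proof (cases "v \<le> 1")
      case True
      then have "(v powr (1 / \<alpha>)) ^ DIM('a) \<le> 1"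
        using \<open>0 \<le> v\<close> assms by (intro power_le_one) (auto intro: powr_le1)
      then show ?thesis using \<open>0 \<le> v\<close> by (simp add: add_increasing2)
    next
      case False
      then have "(v powr (1 / \<alpha>)) ^ DIM('a) = v powr (DIM('a) / \<alpha>)"
        by (simp add: powr_power)
      also have "\<dots> \<le> v powr m"
        using False by (intro powr_mono) (auto simp: m_def real_nat_ceiling_ge)
      finally show ?thesis using False by (simp add: powr_realpow)
    qed
    finally show ?thesis using True by (simp add: ennreal_leI mult_left_mono)
  next
    case False
    then have "\<not> norm t powr \<alpha> \<le> v" for t :: 'a
      using powr_ge_zero[of "norm t" \<alpha>] by linarith
    then show ?thesis by simp
  qed
  have "(\<integral>\<^sup>+t. ennreal (exp (- (norm (t::'a) powr \<alpha>))) \<partial>lborel)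
      = (\<integral>\<^sup>+t. (\<integral>\<^sup>+v. ennreal (exp (- v)) * indicator {norm (t::'a) powr \<alpha>..} v \<partial>lborel) \<partial>lborel)"
    by (simp add: exp_neg_layer_cake)
  also have "\<dots> = (\<integral>\<^sup>+v. (\<integral>\<^sup>+t. ennreal (exp (- v)) * indicator {norm (t::'a) powr \<alpha>..} v \<partial>lborel) \<partial>lborel)"
    unfolding atLeast_def indicator_def by (rule lborel_pair.Fubini'[symmetric]) measurable
  also have "\<dots> \<le> (\<integral>\<^sup>+v. ennreal (exp (- v)) * (ennreal (?c * (1 + v ^ m)) * indicator {0..} v) \<partial>lborel)"
  proof (rule nn_integral_mono)
    fix v :: real
    have [measurable]: "(\<lambda>t::'a. indicator {norm t powr \<alpha>..} v :: ennreal) \<in> borel_measurable borel"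
      unfolding atLeast_def indicator_def by measurable
    show "(\<integral>\<^sup>+t. ennreal (exp (- v)) * indicator {norm (t::'a) powr \<alpha>..} v \<partial>lborel)
      \<le> ennreal (exp (- v)) * (ennreal (?c * (1 + v ^ m)) * indicator {0..} v)"
      by (subst nn_integral_cmult) (auto intro!: mult_left_mono vol)
  qed
  also have "\<dots> = (\<integral>\<^sup>+v. ennreal ?c * (ennreal (v ^ 0 * exp (- v)) * indicator {0..} v + ennreal (v ^ m * exp (- v)) * indicator {0..} v) \<partial>lborel)"
    by (intro nn_integral_cong)
      (auto simp: indicator_def algebra_simps simp flip: ennreal_mult' ennreal_plus)
  also have "\<dots> = ennreal ?c * (1 + ennreal (fact m))"
    by (simp add: nn_integral_cmult nn_integral_add nn_intergal_power_times_exp_Ici[of m] nn_intergal_power_times_exp_Ici[of 0, simplified])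
  also have "\<dots> < \<infinity>" by (simp add: ennreal_mult_less_top)
  finally show "(\<integral>\<^sup>+t. ennreal (exp (- (norm (t::'a) powr \<alpha>))) \<partial>lborel) < \<infinity>" .
qed auto

text \<open>The witness is the \<open>m\<close>-fold convolution power of \<open>M\<close>, the law
  of a sum of \<open>m\<close> independent copies, starting from the point mass at the
  origin.\<close>

lemma ex_char_power:
  fixes M :: "'a::euclidean_space measure"
  assumes "prob_space M" and sets_M: "sets M = sets borel"
  shows "\<exists>N :: 'a measure. prob_space N \<and> sets N = sets borel \<and>
    (\<forall>t. (LINT y|N. iexp (y \<bullet> t)) = (LINT y|M. iexp (y \<bullet> t)) ^ m)"
proof (induction m)
  case 0
  show ?case
    by (intro exI[of _ "return borel 0"]) (auto intro!: prob_space_return simp: integral_return)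
next
  case (Suc m)
  then obtain N :: "'a measure" where N: "prob_space N" and sets_N: "sets N = sets borel"
    and char: "\<And>t. (LINT y|N. iexp (y \<bullet> t)) = (LINT y|M. iexp (y \<bullet> t)) ^ m"
    by blast
  note [measurable_cong] = sets_M sets_N
  interpret M: prob_space M by fact
  interpret N: prob_space N by fact
  interpret P: pair_prob_space M N ..
  let ?K = "distr (M \<Otimes>\<^sub>M N) borel (\<lambda>(a, b). a + b)"
  have "(LINT y|?K. iexp (y \<bullet> t)) = (LINT y|M. iexp (y \<bullet> t)) ^ Suc m" for t
  proof -
    let ?f = "\<lambda>(a, b). iexp (a \<bullet> t) * iexp (b \<bullet> t)"
    have int: "integrable (M \<Otimes>\<^sub>M N) ?f"
      by (rule P.integrable_const_bound[of _ 1]) (auto simp: norm_mult)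
    have "(LINT y|?K. iexp (y \<bullet> t)) = integral\<^sup>L (M \<Otimes>\<^sub>M N) ?f"
      by (subst integral_distr) (auto simp: split_beta' inner_add_left exp_add distrib_left)
    also have "\<dots> = (LINT a|M. (LINT b|N. iexp (a \<bullet> t) * iexp (b \<bullet> t)))"
      using P.integral_fst'[OF int] by simp
    also have "\<dots> = (LINT y|M. iexp (y \<bullet> t)) ^ Suc m"
      by (simp add: char)
    finally show ?thesis .
  qed
  moreover have "prob_space ?K"
    by (rule P.prob_space_distr) measurable
  ultimately show ?case
    by (intro exI[of _ ?K]) auto
qed

text \<open>An orthogonal map taking \<open>s\<close> to \<open>t\<close> preserves Lebesgue
  measure, inner products and \<open>f\<close>, so it may be substituted into the integral.\<close>

lemma density_char_orthogonal:
  fixes f :: "real ^ 'n \<Rightarrow> real"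
  assumes [measurable]: "f \<in> borel_measurable borel" and radial: "\<And>x y. norm x = norm y \<Longrightarrow> f x = f y"
    and "norm s = norm t"
  shows "density_char f s = density_char f t"
proof -
  obtain T where T: "orthogonal_transformation T" "T s = t"
    using \<open>norm s = norm t\<close> by (rule orthogonal_transformation_exists)
  then have [measurable]: "T \<in> borel_measurable borel"
    by (intro borel_measurable_continuous_onI linear_continuous_on)
      (simp add: orthogonal_transformation_linear flip: linear_conv_bounded_linear)
  have "f (T x) = f x" for x
    using T by (intro radial) (simp add: orthogonal_transformation)
  moreover have "T x \<bullet> t = x \<bullet> s" for x
    using T by (auto simp: orthogonal_transformation_def)
  ultimately show ?thesis
    unfolding density_char_def
    by (subst (2) distr_lborel_orthogonal[OF T(1), symmetric]) (simp add: integral_distr)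
qed

text \<open>The function \<open>exp (- (norm t powr \<alpha>))\<close> is even, so both sign
  conventions give the same integral. That integral is thus its own conjugate, and \<open>Re\<close>
  in \<open>stable_density\<close> loses nothing.\<close>

lemma
  fixes x :: "'a::euclidean_space"
  assumes "0 < \<alpha>"
  shows density_char_exp_neg_norm_powr: "density_char (\<lambda>t. exp (- (norm t powr \<alpha>))) x
      = complex_of_real ((2 * pi) ^ DIM('a) * stable_density \<alpha> x)" (is ?A)
    and stable_fourier_integral: "(LINT t|lborel. iexp (- (t \<bullet> x)) * complex_of_real (exp (- (norm t powr \<alpha>))))
      = complex_of_real ((2 * pi) ^ DIM('a) * stable_density \<alpha> x)" (is ?B)
proof -
  let ?\<psi> = "\<lambda>t::'a. exp (- (norm t powr \<alpha>))"
  let ?J = "LINT t|lborel. iexp (- (t \<bullet> x)) * complex_of_real (?\<psi> t)"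
  have J: "density_char ?\<psi> x = ?J"
    unfolding density_char_def by (subst lborel_integral_affine[of _ "-1" 0]) auto
  have "cnj ?J = density_char ?\<psi> x"
    unfolding density_char_def by (subst Bochner_Integration.integral_cnj[symmetric]) (simp add: exp_cnj)
  then have "?J = complex_of_real (Re ?J)"
    by (simp add: J complex_eq_iff)
  moreover have "Re ?J = (2 * pi) ^ DIM('a) * stable_density \<alpha> x"
    unfolding stable_density_def by (simp add: Re_divide_of_real)
  ultimately show ?B by simp
  then show ?A by (simp add: J)
qed

lemma stable_density_measurable[measurable]:
  "(stable_density \<alpha> :: 'a::euclidean_space \<Rightarrow> real) \<in> borel_measurable borel"
  unfolding stable_density_def[abs_def] by measurable

lemma stable_density_radial:
  fixes x y :: "real ^ 'n"
  assumes "0 < \<alpha>" "norm x = norm y"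
  shows "stable_density \<alpha> x = stable_density \<alpha> y"
proof -
  have "density_char (\<lambda>t::real^'n. exp (- (norm t powr \<alpha>))) x = density_char (\<lambda>t. exp (- (norm t powr \<alpha>))) y"
    using assms by (intro density_char_orthogonal) auto
  then show ?thesis
    unfolding density_char_exp_neg_norm_powr[OF \<open>0 < \<alpha>\<close>] by simp
qed

text \<open>The scale is chosen so that the rescaled norm to the power \<alpha> is
  \<open>X / Suc m\<close> with \<open>X = norm t powr \<alpha> / \<nu>\<close>. The expression
  becomes \<open>(1 + X / Suc m) ^ Suc m\<close> raised to \<open>- \<nu>\<close>, and the \<nu> in
  \<open>X\<close> cancels in the limit.\<close>

lemma scaled_power_tendsto_exp:
  fixes \<alpha> \<nu> :: real and t :: "'a::euclidean_space"
  assumes "0 < \<alpha>" "0 < \<nu>"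
  shows "(\<lambda>m. ((1 + norm ((1 / (Suc m * \<nu>)) powr (1 / \<alpha>) *\<^sub>R t) powr \<alpha>) powr (- \<nu>)) ^ Suc m)
    \<longlonglongrightarrow> exp (- (norm t powr \<alpha>))"
proof -
  let ?X = "norm t powr \<alpha> / \<nu>"
  have "((1 + norm ((1 / (Suc m * \<nu>)) powr (1 / \<alpha>) *\<^sub>R t) powr \<alpha>) powr (- \<nu>)) ^ Suc m
      = ((1 + ?X / Suc m) ^ Suc m) powr (- \<nu>)" for m
  proof -
    have "norm ((1 / (Suc m * \<nu>)) powr (1 / \<alpha>) *\<^sub>R t) powr \<alpha> = ?X / Suc m"
      using assms by (simp add: powr_mult powr_powr field_simps)
    moreover have "0 < 1 + ?X / Suc m"
      using assms by (intro add_pos_nonneg) auto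
    ultimately show ?thesis
      by (simp add: powr_powr powr_power mult.commute flip: powr_realpow del: power_Suc of_nat_Suc)
  qed
  moreover have "(\<lambda>m. ((1 + ?X / Suc m) ^ Suc m) powr (- \<nu>)) \<longlonglongrightarrow> exp ?X powr (- \<nu>)"
    using LIMSEQ_Suc[OF tendsto_exp_limit_sequentially[of ?X]] by (intro tendsto_powr) auto
  moreover have "exp ?X powr (- \<nu>) = exp (- (norm t powr \<alpha>))"
    using assms by (simp add: powr_def)
  ultimately show ?thesis by simp
qed

lemma gaussian_dilation_tendsto:
  "(\<lambda>k. exp (- (norm ((1 / Suc k) *\<^sub>R (t :: 'a::real_normed_vector)))\<^sup>2 / 2)) \<longlonglongrightarrow> 1"
proof -
  have "(\<lambda>k. exp (- (norm ((1 / Suc k) *\<^sub>R t))\<^sup>2 / 2)) \<longlonglongrightarrow> exp (- (norm (0 *\<^sub>R t))\<^sup>2 / 2)"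
    by (intro tendsto_intros LIMSEQ_Suc[OF lim_1_over_n]) auto
  then show ?thesis by simp
qed

text \<open>Each approximant is the characteristic function of a probability measure, so its
  Gaussian-smoothed inverse transform is nonnegative by \<open>gaussian_smoothing\<close>. Two
  limits carry this to the stable density. The Gaussian must stay in place during the first, because
  the approximants themselves may fail to be integrable.\<close>

lemma stable_density_nonneg:
  fixes p :: "'a::euclidean_space \<Rightarrow> real"
  assumes p: "is_linnik_density \<alpha> \<nu> p" and "0 < \<alpha>" "0 < \<nu>"
  shows "0 \<le> stable_density \<alpha> (x::'a)"
proof -
  let ?\<psi> = "\<lambda>t::'a. exp (- (norm t powr \<alpha>))"
  define c where "c m = (1 / (Suc m * \<nu>)) powr (1 / \<alpha>)" for m :: nat
  define \<phi> where "\<phi> m t = ((1 + norm (c m *\<^sub>R t) powr \<alpha>) powr (- \<nu>)) ^ Suc m" for m and t :: 'a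
  define G where "G \<sigma> t = exp (- (norm (\<sigma> *\<^sub>R t))\<^sup>2 / 2)" for \<sigma> and t :: 'a
  define M where "M = density lborel (\<lambda>y. ennreal (p y))"
  have [measurable]: "p \<in> borel_measurable borel" and p_nonneg: "\<And>y. 0 \<le> p y" and M: "prob_space M"
    and p_char: "\<And>t. density_char p t = complex_of_real ((1 + norm t powr \<alpha>) powr (- \<nu>))"
    using p by (auto simp: is_linnik_density_def is_probability_density_def M_def)
  have M_char: "(LINT y|M. iexp (y \<bullet> t)) = complex_of_real ((1 + norm t powr \<alpha>) powr (- \<nu>))" for t
    unfolding p_char[symmetric] M_def density_char_def using p_nonneg
    by (subst integral_density) (auto simp: scaleR_conv_of_real mult.commute)
  have G_int: "integrable lborel (G \<sigma>)" if "0 < \<sigma>" for \<sigma>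
    unfolding G_def using that by (rule integrable_gaussian)
  have [measurable]: "G \<sigma> \<in> borel_measurable borel" "\<phi> m \<in> borel_measurable borel" for \<sigma> m
    unfolding G_def \<phi>_def by measurable
  have \<phi>_le: "norm (\<phi> m t) \<le> 1" for m t
  proof -
    have "(1 + norm (c m *\<^sub>R t) powr \<alpha>) powr (- \<nu>) \<le> 1 powr (- \<nu>)"
      using \<open>0 < \<nu>\<close> by (intro powr_mono2') auto
    then show ?thesis by (auto simp: \<phi>_def intro!: power_le_one simp del: power_Suc)
  qed
  have nonneg_m: "0 \<le> Re (LINT t|lborel. iexp (- (t \<bullet> x)) * complex_of_real (\<phi> m t) * complex_of_real (G \<sigma> t))"
    if "0 < \<sigma>" for \<sigma> m
  proof -
    obtain N :: "'a measure" where N: "prob_space N" and sets_N: "sets N = sets borel"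
      and N_char: "\<And>t. (LINT y|N. iexp (y \<bullet> t)) = (LINT y|M. iexp (y \<bullet> t)) ^ Suc m"
      using ex_char_power[OF M, of "Suc m"] by (auto simp: M_def)
    note [measurable_cong] = sets_N
    interpret N: prob_space N by fact
    let ?K = "distr N borel (\<lambda>y. c m *\<^sub>R y)"
    have K: "finite_measure ?K"
      by (intro prob_space.finite_measure N.prob_space_distr) measurable
    have "(LINT y|?K. iexp (y \<bullet> t)) = complex_of_real (\<phi> m t)" for t
    proof -
      have "(LINT y|?K. iexp (y \<bullet> t)) = (LINT y|N. iexp (y \<bullet> (c m *\<^sub>R t)))"
        by (subst integral_distr) auto
      then show ?thesis
        unfolding N_char M_char \<phi>_def by simp
    qed
    then have "(LINT t|lborel. iexp (- (t \<bullet> x)) * complex_of_real (\<phi> m t) * complex_of_real (G \<sigma> t))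
      = complex_of_real (LINT y|?K. (sqrt (2 * pi) / \<sigma>) ^ DIM('a) * exp (- (norm ((y - x) /\<^sub>R \<sigma>))\<^sup>2 / 2))"
      using gaussian_smoothing[OF K _ that, of x] by (simp add: G_def)
    then show ?thesis
      using that by simp
  qed
  \<comment> \<open>First limit, in \<open>m\<close> at fixed \<sigma>: the approximants are bounded
    by 1, so the Gaussian is the majorant.\<close>
  have nonneg_\<sigma>: "0 \<le> Re (LINT t|lborel. iexp (- (t \<bullet> x)) * complex_of_real (?\<psi> t) * complex_of_real (G \<sigma> t))"
    if "0 < \<sigma>" for \<sigma>
  proof (rule tendsto_lowerbound)
    show "(\<lambda>m. Re (LINT t|lborel. iexp (- (t \<bullet> x)) * complex_of_real (\<phi> m t) * complex_of_real (G \<sigma> t)))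
      \<longlonglongrightarrow> Re (LINT t|lborel. iexp (- (t \<bullet> x)) * complex_of_real (?\<psi> t) * complex_of_real (G \<sigma> t))"
    proof (intro tendsto_Re integral_dominated_convergence[OF _ _ G_int[OF that]] AE_I2)
      fix t
      show "(\<lambda>m. iexp (- (t \<bullet> x)) * complex_of_real (\<phi> m t) * complex_of_real (G \<sigma> t))
        \<longlonglongrightarrow> iexp (- (t \<bullet> x)) * complex_of_real (?\<psi> t) * complex_of_real (G \<sigma> t)"
        using scaled_power_tendsto_exp[OF \<open>0 < \<alpha>\<close> \<open>0 < \<nu>\<close>, of t]
        unfolding \<phi>_def c_def by (intro tendsto_mult tendsto_const tendsto_of_real)
      show "norm (iexp (- (t \<bullet> x)) * complex_of_real (\<phi> m t) * complex_of_real (G \<sigma> t)) \<le> G \<sigma> t" for m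
        using mult_right_mono[OF \<phi>_le, of "G \<sigma> t" m t] by (simp add: norm_mult G_def)
    qed auto
  qed (use nonneg_m[OF that] in auto)
  \<comment> \<open>Second limit, removing the Gaussian: now the integrable limit function
    \<open>?\<psi>\<close> is the majorant.\<close>
  have "0 \<le> Re (LINT t|lborel. iexp (- (t \<bullet> x)) * complex_of_real (?\<psi> t))"
  proof (rule tendsto_lowerbound)
    show "(\<lambda>k. Re (LINT t|lborel. iexp (- (t \<bullet> x)) * complex_of_real (?\<psi> t) * complex_of_real (G (1 / Suc k) t)))
      \<longlonglongrightarrow> Re (LINT t|lborel. iexp (- (t \<bullet> x)) * complex_of_real (?\<psi> t))"
    proof (intro tendsto_Re integral_dominated_convergence[OF _ _ integrable_exp_neg_norm_powr[OF \<open>0 < \<alpha>\<close>]] AE_I2)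
      fix t
      have "(\<lambda>k. G (1 / Suc k) t) \<longlonglongrightarrow> 1"
        unfolding G_def by (rule gaussian_dilation_tendsto)
      then have "(\<lambda>k. iexp (- (t \<bullet> x)) * complex_of_real (?\<psi> t) * complex_of_real (G (1 / Suc k) t))
        \<longlonglongrightarrow> iexp (- (t \<bullet> x)) * complex_of_real (?\<psi> t) * complex_of_real 1"
        by (intro tendsto_mult tendsto_const tendsto_of_real)
      then show "(\<lambda>k. iexp (- (t \<bullet> x)) * complex_of_real (?\<psi> t) * complex_of_real (G (1 / Suc k) t))
        \<longlonglongrightarrow> iexp (- (t \<bullet> x)) * complex_of_real (?\<psi> t)"
        by simp
      show "norm (iexp (- (t \<bullet> x)) * complex_of_real (?\<psi> t) * complex_of_real (G (1 / Suc k) t)) \<le> ?\<psi> t" for k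
        by (simp add: norm_mult G_def)
    qed auto
  qed (use nonneg_\<sigma> in auto)
  then have "0 \<le> (2 * pi) ^ DIM('a) * stable_density \<alpha> x"
    unfolding stable_fourier_integral[OF \<open>0 < \<alpha>\<close>] Re_complex_of_real .
  moreover have "0 < (2 * pi) ^ DIM('a)"
    by simp
  ultimately show ?thesis
    by (metis mult_pos_neg not_le)
qed

text \<open>Fourier inversion is applied to \<open>exp (- (norm t powr \<alpha>))\<close> itself,
  which is nonnegative, integrable and continuous, and whose transform is a multiple of
  \<open>stable_density\<close>. Integrability of the latter is a conclusion: damped by a Gaussian
  it is integrable because it is bounded, and the damping is then removed monotonically.\<close>

lemma
  assumes nonneg: "\<And>x::'a::euclidean_space. 0 \<le> stable_density \<alpha> x" and "0 < \<alpha>"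
  shows integrable_stable_density: "integrable lborel (stable_density \<alpha> :: 'a \<Rightarrow> real)"
    and density_char_stable_density: "density_char (stable_density \<alpha>) (t::'a) = complex_of_real (exp (- (norm t powr \<alpha>)))"
proof -
  let ?\<psi> = "\<lambda>t::'a. exp (- (norm t powr \<alpha>))"
  let ?s = "stable_density \<alpha> :: 'a \<Rightarrow> real"
  define G where "G k t = exp (- (norm ((1 / Suc k) *\<^sub>R t))\<^sup>2 / 2)" for k and t :: 'a
  have [measurable]: "G k \<in> borel_measurable borel" for k
    unfolding G_def by measurable
  have G_int: "integrable lborel (G k)" for k
    unfolding G_def by (rule integrable_gaussian) simp
  have G_le: "0 \<le> G k t" "G k t \<le> 1" for k t
    by (auto simp: G_def)
  have G_lim: "(\<lambda>k. G k t) \<longlonglongrightarrow> 1" for t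
    unfolding G_def by (rule gaussian_dilation_tendsto)
  have lim: "(\<lambda>k. LINT t|lborel. iexp (- (t \<bullet> x)) * complex_of_real (?s t * G k t)) \<longlonglongrightarrow> complex_of_real (?\<psi> x)" for x
  proof -
    have "continuous_on UNIV ?\<psi>"
      using \<open>0 < \<alpha>\<close> by (intro continuous_intros continuous_on_powr') auto
    then have cont: "isCont ?\<psi> x"
      by (simp add: continuous_on_eq_continuous_at)
    have "(\<lambda>k. LINT t|lborel. iexp (- (t \<bullet> x)) * density_char ?\<psi> t * complex_of_real (G k t))
      \<longlonglongrightarrow> complex_of_real ((2 * pi) ^ DIM('a) * ?\<psi> x)"
      unfolding G_def using \<open>0 < \<alpha>\<close>
      by (intro fourier_inversion_smoothed integrable_exp_neg_norm_powr cont) auto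
    moreover have "(LINT t|lborel. iexp (- (t \<bullet> x)) * density_char ?\<psi> t * complex_of_real (G k t))
      = complex_of_real ((2 * pi) ^ DIM('a)) * (LINT t|lborel. iexp (- (t \<bullet> x)) * complex_of_real (?s t * G k t))" for k
      unfolding integral_mult_right_zero[symmetric] density_char_exp_neg_norm_powr[OF \<open>0 < \<alpha>\<close>]
      by (simp add: mult_ac)
    ultimately have "(\<lambda>k. complex_of_real ((2 * pi) ^ DIM('a)) * (LINT t|lborel. iexp (- (t \<bullet> x)) * complex_of_real (?s t * G k t)))
      \<longlonglongrightarrow> complex_of_real ((2 * pi) ^ DIM('a)) * complex_of_real (?\<psi> x)"
      by (simp only: of_real_mult)
    then show ?thesis
      by (subst (asm) tendsto_mult_left_iff) auto
  qed
  have int: "integrable lborel (\<lambda>t. ?s t * G k t)" for k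
  proof (rule Bochner_Integration.integrable_bound)
    have "norm ((2 * pi) ^ DIM('a) * ?s t) \<le> integral\<^sup>L lborel ?\<psi>" for t
    proof -
      have "norm (complex_of_real ((2 * pi) ^ DIM('a) * ?s t)) \<le> (LINT t|lborel. norm (?\<psi> t))"
        unfolding stable_fourier_integral[OF \<open>0 < \<alpha>\<close>, symmetric]
        by (rule order_trans[OF integral_norm_bound]) (simp add: norm_mult)
      then show ?thesis by (simp only: norm_of_real real_norm_def abs_exp_cancel)
    qed
    then have bound: "norm (?s t) \<le> integral\<^sup>L lborel ?\<psi> / (2 * pi) ^ DIM('a)" for t
      by (simp add: field_simps abs_mult)
    show "integrable lborel (\<lambda>t. integral\<^sup>L lborel ?\<psi> / (2 * pi) ^ DIM('a) * G k t)"
      by (intro integrable_mult_right G_int)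
    show "AE t in lborel. norm (?s t * G k t) \<le> norm (integral\<^sup>L lborel ?\<psi> / (2 * pi) ^ DIM('a) * G k t)"
      unfolding norm_mult
      by (intro AE_I2 mult_right_mono order_trans[OF bound]) auto
  qed auto
  have "mono (\<lambda>k. G k t)" for t
    by (auto intro!: monoI mult_right_mono power_mono simp: G_def frac_le)
  then have mono: "mono (\<lambda>k. ?s t * G k t)" for t
    using nonneg by (auto simp: mono_def intro: mult_left_mono)
  have lim': "(\<lambda>k. ?s t * G k t) \<longlonglongrightarrow> ?s t" for t
    using tendsto_mult[OF tendsto_const G_lim] by simp
  \<comment> \<open>Inversion at the origin: the damped integrals tend to the value 1 of
    \<open>?\<psi>\<close> there. This bounded limit is what monotone convergence needs.\<close>
  have ilim: "(\<lambda>k. LINT t|lborel. ?s t * G k t) \<longlonglongrightarrow> 1"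
  proof -
    have "(\<lambda>k. complex_of_real (LINT t|lborel. ?s t * G k t)) \<longlonglongrightarrow> complex_of_real 1"
      using lim[of 0] \<open>0 < \<alpha>\<close> by (simp add: integral_complex_of_real del: of_real_mult)
    then show ?thesis by (simp only: tendsto_of_real_iff)
  qed
  show s_int: "integrable lborel ?s"
    by (rule integral_monotone_convergence_nonneg(1)[OF int _ _ _ ilim]) (use mono lim' nonneg G_le in auto)
  \<comment> \<open>The point \<open>- t\<close> compensates the opposite sign in the inversion
    integral; \<open>?\<psi>\<close> is even.\<close>
  have "(\<lambda>k. LINT y|lborel. iexp (- (y \<bullet> - t)) * complex_of_real (?s y * G k y)) \<longlonglongrightarrow> (LINT y|lborel. iexp (- (y \<bullet> - t)) * complex_of_real (?s y))"
  proof (rule integral_dominated_convergence[OF _ _ s_int])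
    show "AE y in lborel. (\<lambda>k. iexp (- (y \<bullet> - t)) * complex_of_real (?s y * G k y)) \<longlonglongrightarrow> iexp (- (y \<bullet> - t)) * complex_of_real (?s y)"
      by (intro AE_I2 tendsto_mult tendsto_const tendsto_of_real lim')
    show "AE y in lborel. norm (iexp (- (y \<bullet> - t)) * complex_of_real (?s y * G k y)) \<le> ?s y" for k
      using nonneg G_le by (intro AE_I2) (simp add: norm_mult mult_left_le)
  qed auto
  from LIMSEQ_unique[OF this lim] show "density_char ?s t = complex_of_real (?\<psi> t)"
    by (simp add: density_char_def)
qed

section \<open>Gamma mixtures of dilated stable densities\<close>

text \<open>This is Euler's Gamma integral after the substitution
  \<open>y = a * u powr \<alpha>\<close>. It is used with
  \<open>a = 1 + norm t powr \<alpha>\<close>.\<close>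

lemma has_bochner_integral_Gamma_powr:
  fixes \<alpha> \<nu> a :: real
  assumes "0 < \<alpha>" "0 < \<nu>" "0 < a"
  shows "has_bochner_integral lborel
    (\<lambda>u. indicator {0<..} u * (u powr (\<alpha> * \<nu> - 1) * exp (- (a * u powr \<alpha>)))) (Gamma \<nu> * a powr (- \<nu>) / \<alpha>)"
proof -
  let ?g = "\<lambda>u. a * u powr \<alpha>"
  let ?g' = "\<lambda>u. a * (\<alpha> * u powr (\<alpha> - 1))"
  let ?f = "\<lambda>y. y powr (\<nu> - 1) / exp y"
  let ?h = "\<lambda>u. u powr (\<alpha> * \<nu> - 1) * exp (- (a * u powr \<alpha>))"
  \<comment> \<open>The endpoint is dropped so that the substitution is a differentiable bijection
    of the open half-line.\<close>
  have "(?f has_integral Gamma \<nu>) {0<..}"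
    using Gamma_integral_real[OF \<open>0 < \<nu>\<close>]
    by (subst has_integral_spike_set_eq[where T = "{0..}"]) (auto intro: negligible_subset[of "{0}"])
  then have f: "?f absolutely_integrable_on {0<..}" "integral {0<..} ?f = Gamma \<nu>"
    by (auto intro!: nonnegative_absolutely_integrable_1 simp: has_integral_iff)
  have img: "?g ` {0<..} = {0<..}"
  proof (intro equalityI subsetI)
    fix y :: real assume "y \<in> {0<..}"
    then have "y = ?g ((y / a) powr (1 / \<alpha>))" "(y / a) powr (1 / \<alpha>) \<in> {0<..}"
      using assms by (auto simp: powr_powr)
    then show "y \<in> ?g ` {0<..}" by (rule image_eqI)
  qed (use assms in auto)
  have inj: "inj_on ?g {0<..}"
    using assms by (intro inj_on_inverseI[where g = "\<lambda>y. (y / a) powr (1 / \<alpha>)"]) (simp add: powr_powr)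
  have der: "(?g has_real_derivative ?g' u) (at u within {0<..})" if "u \<in> {0<..}" for u
    using that by (auto intro!: derivative_eq_intros)
  have "(\<lambda>u. \<bar>?g' u\<bar> * ?f (?g u)) absolutely_integrable_on {0<..} \<and>
      integral {0<..} (\<lambda>u. \<bar>?g' u\<bar> * ?f (?g u)) = Gamma \<nu>"
    by (subst has_absolute_integral_change_of_variables_1'[OF _ der inj]) (use f img in auto)
  moreover have eq: "\<bar>?g' u\<bar> * ?f (?g u) = (\<alpha> * a powr \<nu>) * ?h u" if "u \<in> {0<..}" for u
  proof -
    have "u powr (\<alpha> * \<nu> - 1) = u powr (\<alpha> - 1) * (u powr \<alpha>) powr (\<nu> - 1)"
      using that by (simp add: powr_powr algebra_simps flip: powr_add)
    moreover have "a powr \<nu> = a * a powr (\<nu> - 1)"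
      using assms by (simp add: powr_diff)
    ultimately show ?thesis
      using that assms by (simp add: powr_mult exp_minus field_simps)
  qed
  then have "(\<lambda>u. \<bar>?g' u\<bar> * ?f (?g u)) absolutely_integrable_on {0<..} \<longleftrightarrow>
      (\<lambda>u. (\<alpha> * a powr \<nu>) * ?h u) absolutely_integrable_on {0<..}"
    "integral {0<..} (\<lambda>u. \<bar>?g' u\<bar> * ?f (?g u)) = integral {0<..} (\<lambda>u. (\<alpha> * a powr \<nu>) * ?h u)"
    by (intro set_integrable_cong Henstock_Kurzweil_Integration.integral_cong, simp_all only:)+
  ultimately have "(\<lambda>u. (\<alpha> * a powr \<nu>) * ?h u) absolutely_integrable_on {0<..}"
    "integral {0<..} (\<lambda>u. (\<alpha> * a powr \<nu>) * ?h u) = Gamma \<nu>"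
    by (simp_all only:)
  then have h: "?h absolutely_integrable_on {0<..}" "integral {0<..} ?h = Gamma \<nu> * a powr (- \<nu>) / \<alpha>"
    using assms by (auto simp: powr_minus field_simps)
  \<comment> \<open>Absolute integrability refers to completed Lebesgue measure; Borel measurability
    brings the result back to \<open>lborel\<close>.\<close>
  have [measurable]: "(\<lambda>u. indicator {0<..} u * ?h u) \<in> borel_measurable lborel"
    by measurable
  have "integrable lborel (\<lambda>u. indicator {0<..} u * ?h u)"
    using h(1) by (simp add: set_integrable_def integrable_completion)
  moreover have "(LINT u|lborel. indicator {0<..} u * ?h u) = Gamma \<nu> * a powr (- \<nu>) / \<alpha>"
    using set_lebesgue_integral_eq_integral(2)[OF h(1)] h(2)
    by (simp add: set_lebesgue_integral_def integral_completion)
  ultimately show ?thesis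
    by (simp add: has_bochner_integral_iff)
qed

text \<open>With \<open>U = G powr (1 / \<alpha>)\<close>, this is up to the factor
  \<open>\<alpha> / Gamma \<nu>\<close> the joint density of \<open>U\<close> and
  \<open>U * S\<close>. The variable \<open>U\<close> contributes
  \<open>u powr (\<alpha> * \<nu> - 1) * exp (- (u powr \<alpha>))\<close>; dilating
  \<open>S\<close> by \<open>u\<close> contributes the missing
  \<open>u powr (- real DIM('a))\<close>.\<close>

definition stable_mixture_integrand :: "real \<Rightarrow> real \<Rightarrow> real \<Rightarrow> 'a::euclidean_space \<Rightarrow> real" where
  "stable_mixture_integrand \<alpha> \<nu> u x = indicator {0<..} u *
     (u powr (\<alpha> * \<nu> - real DIM('a) - 1) * exp (- (u powr \<alpha>)) * stable_density \<alpha> (x /\<^sub>R u))"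

definition stable_mixture :: "real \<Rightarrow> real \<Rightarrow> 'a::euclidean_space \<Rightarrow> real" where
  "stable_mixture \<alpha> \<nu> x = \<alpha> / Gamma \<nu> * (LINT u|lborel. stable_mixture_integrand \<alpha> \<nu> u x)"

lemma stable_mixture_integrand_measurable[measurable (raw)]:
  assumes [measurable]: "f \<in> borel_measurable M" "g \<in> borel_measurable M"
  shows "(\<lambda>z. stable_mixture_integrand \<alpha> \<nu> (f z) (g z :: 'a::euclidean_space)) \<in> borel_measurable M"
  unfolding stable_mixture_integrand_def greaterThan_def indicator_def by measurable

context
  fixes \<alpha> \<nu> :: real and dummy :: "'a::euclidean_space itself"
  assumes \<alpha>: "0 < \<alpha>" and \<nu>: "0 < \<nu>" and s_nonneg: "\<And>x::'a. 0 \<le> stable_density \<alpha> x"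
begin

lemma stable_mixture_integrand_nonneg: "0 \<le> stable_mixture_integrand \<alpha> \<nu> u (x::'a)"
  using s_nonneg by (simp add: stable_mixture_integrand_def)

text \<open>Substituting \<open>x = u * y\<close> cancels the dimension in the exponent and
  evaluates the stable characteristic function at \<open>u *\<^sub>R t\<close>; its exponential
  merges with \<open>exp (- (u powr \<alpha>))\<close>.\<close>

lemma
  shows integrable_stable_mixture_integrand_snd: "integrable lborel (stable_mixture_integrand \<alpha> \<nu> u :: 'a \<Rightarrow> real)"
    and density_char_stable_mixture_integrand:
      "density_char (stable_mixture_integrand \<alpha> \<nu> u) (t::'a) = complex_of_real
        (indicator {0<..} u * (u powr (\<alpha> * \<nu> - 1) * exp (- ((1 + norm t powr \<alpha>) * u powr \<alpha>))))"
proof -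
  let ?w = "u powr (\<alpha> * \<nu> - real DIM('a) - 1) * exp (- (u powr \<alpha>))"
  show "integrable lborel (stable_mixture_integrand \<alpha> \<nu> u :: 'a \<Rightarrow> real)"
    unfolding stable_mixture_integrand_def
  proof (intro integrable_mult_right)
    assume "indicator {0<..} u \<noteq> (0::real)"
    then have "inverse u \<noteq> 0" by (auto simp: indicator_def split: if_splits)
    from lborel_integrable_affine[OF integrable_stable_density[OF s_nonneg \<alpha>] this, of 0]
    show "integrable lborel (\<lambda>x::'a. stable_density \<alpha> (x /\<^sub>R u))" by simp
  qed
  show "density_char (stable_mixture_integrand \<alpha> \<nu> u) t = complex_of_real
        (indicator {0<..} u * (u powr (\<alpha> * \<nu> - 1) * exp (- ((1 + norm t powr \<alpha>) * u powr \<alpha>))))"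
  proof (cases "0 < u")
    case True
    have "density_char (stable_mixture_integrand \<alpha> \<nu> u) t
      = (LINT x|lborel. complex_of_real ?w * (iexp (x \<bullet> t) * complex_of_real (stable_density \<alpha> (x /\<^sub>R u))))"
      using True by (simp add: density_char_def stable_mixture_integrand_def mult_ac)
    also have "\<dots> = complex_of_real ?w * (LINT x|lborel. iexp (x \<bullet> t) * complex_of_real (stable_density \<alpha> (x /\<^sub>R u)))"
      by (rule integral_mult_right_zero)
    also have "(LINT x|lborel. iexp (x \<bullet> t) * complex_of_real (stable_density \<alpha> (x /\<^sub>R u)))
      = complex_of_real (u ^ DIM('a)) * density_char (stable_density \<alpha>) (u *\<^sub>R t)"
      using True unfolding density_char_def
      by (subst lborel_integral_affine[of _ u 0]) (auto simp: scaleR_conv_of_real)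
    also have "density_char (stable_density \<alpha>) (u *\<^sub>R t) = complex_of_real (exp (- (u powr \<alpha> * norm t powr \<alpha>)))"
      using True by (simp add: density_char_stable_density[OF s_nonneg \<alpha>] powr_mult)
    also have "complex_of_real ?w * (complex_of_real (u ^ DIM('a)) * complex_of_real (exp (- (u powr \<alpha> * norm t powr \<alpha>))))
      = complex_of_real ((u powr (\<alpha> * \<nu> - real DIM('a) - 1) * u powr real DIM('a)) * (exp (- (u powr \<alpha>)) * exp (- (u powr \<alpha> * norm t powr \<alpha>))))"
      using True by (simp add: powr_realpow)
    also have "(u powr (\<alpha> * \<nu> - real DIM('a) - 1) * u powr real DIM('a)) * (exp (- (u powr \<alpha>)) * exp (- (u powr \<alpha> * norm t powr \<alpha>)))
      = u powr (\<alpha> * \<nu> - 1) * exp (- ((1 + norm t powr \<alpha>) * u powr \<alpha>))"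
      by (simp add: algebra_simps flip: powr_add exp_add)
    finally show ?thesis using True by simp
  qed (simp add: density_char_def stable_mixture_integrand_def)
qed

lemma integrable_stable_mixture_integrand:
  "integrable (lborel \<Otimes>\<^sub>M lborel) (\<lambda>(u, x::'a). stable_mixture_integrand \<alpha> \<nu> u x)"
proof (rule lborel_pair.Fubini_integrable)
  \<comment> \<open>The integrand is nonnegative, so its norm integrates over \<open>x\<close> to
    the transform at frequency 0, which is a Gamma integrand with \<open>a = 1\<close>.\<close>
  have "complex_of_real (LINT x|lborel. stable_mixture_integrand \<alpha> \<nu> u (x::'a)) = density_char (stable_mixture_integrand \<alpha> \<nu> u) (0::'a)" for u
    by (simp add: density_char_def integral_complex_of_real)
  then have "(LINT x|lborel. stable_mixture_integrand \<alpha> \<nu> u (x::'a))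
      = indicator {0<..} u * (u powr (\<alpha> * \<nu> - 1) * exp (- (1 * u powr \<alpha>)))" for u
    using \<alpha> unfolding density_char_stable_mixture_integrand of_real_eq_iff by simp
  moreover have "integrable lborel (\<lambda>u. indicator {0<..} u * (u powr (\<alpha> * \<nu> - 1) * exp (- (1 * u powr \<alpha>))))"
    using has_bochner_integral_Gamma_powr[OF \<alpha> \<nu>, of 1] by (simp add: has_bochner_integral_iff)
  ultimately show "integrable lborel (\<lambda>u. LINT x|lborel. norm (case (u, x::'a) of (u, x) \<Rightarrow> stable_mixture_integrand \<alpha> \<nu> u x))"
    by (simp add: stable_mixture_integrand_nonneg)
qed (auto simp: integrable_stable_mixture_integrand_snd)

lemma integrable_stable_mixture: "integrable lborel (stable_mixture \<alpha> \<nu> :: 'a \<Rightarrow> real)"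
  unfolding stable_mixture_def
  by (intro integrable_mult_right lborel_pair.integrable_snd integrable_stable_mixture_integrand)

lemma density_char_stable_mixture:
  "density_char (stable_mixture \<alpha> \<nu>) (t::'a) = complex_of_real ((1 + norm t powr \<alpha>) powr (- \<nu>))"
proof -
  let ?F = "\<lambda>u (x::'a). iexp (x \<bullet> t) * complex_of_real (stable_mixture_integrand \<alpha> \<nu> u x)"
  have int: "integrable (lborel \<Otimes>\<^sub>M lborel) (case_prod ?F)"
    by (rule Bochner_Integration.integrable_bound[OF integrable_stable_mixture_integrand])
      (auto simp: split_beta' norm_mult)
  have "density_char (stable_mixture \<alpha> \<nu>) t = (LINT x|lborel. complex_of_real (\<alpha> / Gamma \<nu>) * (LINT u|lborel. ?F u x))"
    unfolding density_char_def stable_mixture_def integral_mult_right_zero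
    by (simp add: integral_complex_of_real mult_ac)
  also have "\<dots> = complex_of_real (\<alpha> / Gamma \<nu>) * (LINT u|lborel. (LINT x|lborel. ?F u x))"
    by (subst integral_mult_right_zero, subst lborel_pair.Fubini_integral[OF int]) (rule refl)
  also have "\<dots> = complex_of_real (\<alpha> / Gamma \<nu>) * (LINT u|lborel. complex_of_real
        (indicator {0<..} u * (u powr (\<alpha> * \<nu> - 1) * exp (- ((1 + norm t powr \<alpha>) * u powr \<alpha>)))))"
    unfolding density_char_stable_mixture_integrand[symmetric] density_char_def ..
  also have "\<dots> = complex_of_real (\<alpha> / Gamma \<nu> * (Gamma \<nu> * (1 + norm t powr \<alpha>) powr (- \<nu>) / \<alpha>))"
    unfolding integral_complex_of_real of_real_mult[of "\<alpha> / Gamma \<nu>"]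
      has_bochner_integral_integral_eq[OF has_bochner_integral_Gamma_powr[OF \<alpha> \<nu> add_pos_nonneg[OF zero_less_one powr_ge_zero]]] ..
  also have "\<dots> = complex_of_real ((1 + norm t powr \<alpha>) powr (- \<nu>))"
    using \<alpha> Gamma_real_pos[OF \<nu>] by simp
  finally show ?thesis .
qed

end

section \<open>Convergence and continuity of the mixture off the origin\<close>

text \<open>The integrand after substituting \<open>u = r * v\<close> with \<open>r = norm x\<close>, up to a power of \<open>r\<close>; \<open>e\<close> is an
  arbitrary unit vector.\<close>

definition dilated_integrand :: "real \<Rightarrow> real \<Rightarrow> 'a::euclidean_space \<Rightarrow> real \<Rightarrow> real \<Rightarrow> real" where
  "dilated_integrand \<alpha> \<nu> e r v = indicator {0<..} v *
     (v powr (\<alpha> * \<nu> - real DIM('a) - 1) * exp (- ((r * v) powr \<alpha>)) * stable_density \<alpha> (e /\<^sub>R v))"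

lemma dilated_integrand_measurable[measurable]:
  "dilated_integrand \<alpha> \<nu> e r \<in> borel_measurable borel"
  unfolding dilated_integrand_def[abs_def] by measurable

lemma radial_profile_eqI:
  assumes "\<And>y. norm y = norm x \<Longrightarrow> f y = f x"
  shows "radial_profile f (norm x) = f x"
  unfolding radial_profile_def using assms by (intro the_equality) blast+

context
  fixes \<alpha> \<nu> :: real and e :: "real ^ 'n"
  assumes \<alpha>: "0 < \<alpha>" and \<nu>: "0 < \<nu>" and s_nonneg: "\<And>x::real^'n. 0 \<le> stable_density \<alpha> x"
    and e: "norm e = 1"
begin

text \<open>The points \<open>x /\<^sub>R (norm x * v)\<close> and \<open>e /\<^sub>R v\<close> have
  the same norm, so radial symmetry removes \<open>x\<close> from the stable factor.\<close>

lemma stable_mixture_integrand_dilate: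
  fixes x :: "real ^ 'n"
  assumes "x \<noteq> 0"
  shows "stable_mixture_integrand \<alpha> \<nu> (norm x * v) x
    = norm x powr (\<alpha> * \<nu> - real CARD('n) - 1) * dilated_integrand \<alpha> \<nu> e (norm x) v"
proof (cases "0 < v")
  case True
  then have "stable_density \<alpha> (x /\<^sub>R (norm x * v)) = stable_density \<alpha> (e /\<^sub>R v)"
    using assms e by (intro stable_density_radial[OF \<alpha>]) simp
  then show ?thesis
    using True assms by (simp add: stable_mixture_integrand_def dilated_integrand_def powr_mult)
qed (use assms in \<open>auto simp: stable_mixture_integrand_def dilated_integrand_def indicator_def zero_less_mult_iff\<close>)

lemma integrable_stable_mixture_integrand_iff:
  fixes x :: "real ^ 'n"
  assumes "x \<noteq> 0"
  shows "integrable lborel (\<lambda>u. stable_mixture_integrand \<alpha> \<nu> u x) \<longleftrightarrow> integrable lborel (dilated_integrand \<alpha> \<nu> e (norm x))"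
proof -
  have "integrable lborel (\<lambda>u. stable_mixture_integrand \<alpha> \<nu> u x)
    \<longleftrightarrow> integrable lborel (\<lambda>v. stable_mixture_integrand \<alpha> \<nu> (0 + norm x * v) x)"
    using lborel_integrable_real_affine_iff[of "norm x" "\<lambda>u. stable_mixture_integrand \<alpha> \<nu> u x" 0] assms by simp
  then show ?thesis
    using assms by (simp add: stable_mixture_integrand_dilate)
qed

lemma dilated_integrand_nonneg: "0 \<le> dilated_integrand \<alpha> \<nu> e r v"
  using s_nonneg by (simp add: dilated_integrand_def)

lemma dilated_integrand_antimono:
  assumes "0 < r" "r \<le> r'"
  shows "dilated_integrand \<alpha> \<nu> e r' v \<le> dilated_integrand \<alpha> \<nu> e r v"
  using assms s_nonneg \<alpha> unfolding dilated_integrand_def indicator_def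
  by (auto intro!: mult_right_mono mult_left_mono powr_mono2)

lemma integrable_dilated_integrand:
  assumes "0 < r"
  shows "integrable lborel (dilated_integrand \<alpha> \<nu> e r)"
proof -
  \<comment> \<open>Tonelli gives integrability for almost every point only; monotonicity in the radius
    then covers every radius.\<close>
  have "AE x::real^'n in lborel. integrable lborel (\<lambda>u. stable_mixture_integrand \<alpha> \<nu> u x)"
    using lborel_pair.AE_integrable_snd[OF integrable_stable_mixture_integrand[OF \<alpha> \<nu> s_nonneg]] .
  then obtain N where "{x \<in> space lborel. \<not> integrable lborel (\<lambda>u. stable_mixture_integrand \<alpha> \<nu> u (x::real^'n))} \<subseteq> N"
    and "emeasure lborel N = 0" "N \<in> sets lborel"
    by (rule AE_E)
  then have N: "N \<in> null_sets lborel"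
    and int: "\<And>x::real^'n. x \<notin> N \<Longrightarrow> integrable lborel (\<lambda>u. stable_mixture_integrand \<alpha> \<nu> u x)"
    by auto
  \<comment> \<open>A ball has positive measure, so some nonzero point of radius below
    \<open>r\<close> escapes the exceptional set; the origin is excluded because the dilation by
    \<open>norm x\<close> needs \<open>x \<noteq> 0\<close>.\<close>
  have "\<not> ball (0::real^'n) r \<subseteq> insert 0 N"
  proof
    assume "ball (0::real^'n) r \<subseteq> insert 0 N"
    moreover have "insert 0 N \<in> null_sets lborel"
      using null_sets.Un[OF finite_imp_null_set_lborel[of "{0}"] N] by simp
    ultimately have "ball (0::real^'n) r \<in> null_sets lborel"
      by (rule null_sets_subset[rotated 2]) auto
    then show False
      using content_ball_pos[OF \<open>0 < r\<close>, of "0::real^'n"] by (simp add: null_sets_def measure_def)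
  qed
  then obtain x where "x \<in> ball 0 r" "x \<notin> insert 0 N"
    by blast
  then have x: "x \<noteq> 0" "norm x < r" "x \<notin> N"
    by auto
  then have "integrable lborel (dilated_integrand \<alpha> \<nu> e (norm x))"
    using integrable_stable_mixture_integrand_iff int by blast
  then show ?thesis
    by (rule Bochner_Integration.integrable_bound)
      (use dilated_integrand_antimono[of "norm x" r] dilated_integrand_nonneg x in auto)
qed

text \<open>By monotonicity in the radius, the integrand at \<open>r / 2\<close> dominates all those
  at larger radii, hence on a whole neighbourhood of \<open>r\<close>.\<close>

lemma isCont_integral_dilated_integrand:
  assumes "0 < r"
  shows "isCont (\<lambda>r. LINT v|lborel. dilated_integrand \<alpha> \<nu> e r v) r"
proof -
  have "continuous_on {r / 2<..} (\<lambda>r. LINT v|lborel. dilated_integrand \<alpha> \<nu> e r v)"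
  proof (rule continuous_on_sequentiallyI)
    fix u a assume u: "\<forall>n. u n \<in> {r / 2<..}" "u \<longlonglongrightarrow> a"
    show "(\<lambda>n. LINT v|lborel. dilated_integrand \<alpha> \<nu> e (u n) v) \<longlonglongrightarrow> (LINT v|lborel. dilated_integrand \<alpha> \<nu> e a v)"
    proof (rule integral_dominated_convergence)
      show "integrable lborel (dilated_integrand \<alpha> \<nu> e (r / 2))"
        using assms by (intro integrable_dilated_integrand) simp
      show "AE v in lborel. (\<lambda>n. dilated_integrand \<alpha> \<nu> e (u n) v) \<longlonglongrightarrow> dilated_integrand \<alpha> \<nu> e a v"
      proof (rule AE_I2)
        fix v
        show "(\<lambda>n. dilated_integrand \<alpha> \<nu> e (u n) v) \<longlonglongrightarrow> dilated_integrand \<alpha> \<nu> e a v"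
        proof (cases "0 < v")
          case True
          have "0 < u n" for n
            using u(1) assms by (force dest: spec[of _ n])
          then have "eventually (\<lambda>n. 0 \<le> u n * v) sequentially"
            using True by (simp add: less_imp_le)
          then show ?thesis
            unfolding dilated_integrand_def using u(2) \<alpha>
            by (intro tendsto_intros tendsto_powr2) auto
        qed (simp add: dilated_integrand_def)
      qed
      show "AE v in lborel. norm (dilated_integrand \<alpha> \<nu> e (u n) v) \<le> dilated_integrand \<alpha> \<nu> e (r / 2) v" for n
        using u(1)[rule_format, of n] assms dilated_integrand_antimono[of "r / 2" "u n"] dilated_integrand_nonneg
        by (intro AE_I2) simp
    qed auto
  qed
  then show ?thesis
    using assms by (simp add: continuous_on_eq_continuous_at)
qed

text \<open>The separate factor \<open>norm x\<close> is the Jacobian of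
  \<open>u = norm x * v\<close>.\<close>

lemma stable_mixture_eq_dilated:
  fixes x :: "real ^ 'n"
  assumes "x \<noteq> 0"
  shows "stable_mixture \<alpha> \<nu> x = \<alpha> / Gamma \<nu> * (norm x * (norm x powr (\<alpha> * \<nu> - real CARD('n) - 1) *
    (LINT v|lborel. dilated_integrand \<alpha> \<nu> e (norm x) v)))"
  using lborel_integral_real_affine[of "norm x" "\<lambda>u. stable_mixture_integrand \<alpha> \<nu> u x" 0] assms
  by (simp add: stable_mixture_def stable_mixture_integrand_dilate)

lemma isCont_stable_mixture:
  fixes x :: "real ^ 'n"
  assumes "x \<noteq> 0"
  shows "isCont (stable_mixture \<alpha> \<nu>) x"
proof -
  have "isCont (\<lambda>x. \<alpha> / Gamma \<nu> * (norm x * (norm x powr (\<alpha> * \<nu> - real CARD('n) - 1) *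
    (LINT v|lborel. dilated_integrand \<alpha> \<nu> e (norm x) v)))) x"
    using assms
    by (intro continuous_intros isCont_o2[OF _ isCont_integral_dilated_integrand]) auto
  moreover have ev: "eventually (\<lambda>y. stable_mixture \<alpha> \<nu> y = \<alpha> / Gamma \<nu> * (norm y * (norm y powr (\<alpha> * \<nu> - real CARD('n) - 1) *
    (LINT v|lborel. dilated_integrand \<alpha> \<nu> e (norm y) v)))) (nhds x)"
    using eventually_nhds_in_open[of "- {0}" x] assms
    by (auto elim!: eventually_mono simp: stable_mixture_eq_dilated open_Compl)
  ultimately show ?thesis
    using iffD2[OF isCont_cong[OF ev]] by blast
qed

end

theorem proposition2p2:
  fixes \<alpha> \<nu> :: real and p :: "real ^ 'n \<Rightarrow> real" and x :: "real ^ 'n"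
  assumes "0 < \<alpha>" and "\<alpha> \<le> 2" and "0 < \<nu>"
    and "is_linnik_density \<alpha> \<nu> p"
    and "x \<noteq> 0"
  shows "p x = radial_profile p (norm x) \<and>
    set_integrable lborel {0<..}
      (\<lambda>u. u powr (\<alpha> * \<nu> - real CARD('n) - 1) * exp (- (u powr \<alpha>)) *
           radial_profile (stable_density \<alpha> :: real ^ 'n \<Rightarrow> real) (norm x / u)) \<and>
    radial_profile p (norm x) =
      \<alpha> / Gamma \<nu> *
      (LINT u:{0<..}|lborel.
         u powr (\<alpha> * \<nu> - real CARD('n) - 1) * exp (- (u powr \<alpha>)) *
         radial_profile (stable_density \<alpha> :: real ^ 'n \<Rightarrow> real) (norm x / u))"
proof -
  note \<alpha> = \<open>0 < \<alpha>\<close> and \<nu> = \<open>0 < \<nu>\<close>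
  have s_nonneg: "0 \<le> stable_density \<alpha> y" for y :: "real ^ 'n"
    using stable_density_nonneg[OF \<open>is_linnik_density \<alpha> \<nu> p\<close> \<alpha> \<nu>] .
  obtain e :: "real ^ 'n" where e: "norm e = 1"
    using vector_choose_size[of 1] by auto
  note mix = \<alpha> \<nu> s_nonneg
  have p_meas[measurable]: "p \<in> borel_measurable borel" and p_nonneg: "\<And>y. 0 \<le> p y"
    and p_prob: "prob_space (density lborel (\<lambda>y. ennreal (p y)))"
    and p_char: "\<And>t. density_char p t = complex_of_real ((1 + norm t powr \<alpha>) powr (- \<nu>))"
    and p_cont: "continuous_on (- {0}) p"
    using \<open>is_linnik_density \<alpha> \<nu> p\<close> by (auto simp: is_linnik_density_def is_probability_density_def)
  have p_int: "integrable lborel p"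
    using prob_space.emeasure_space_1[OF p_prob] p_nonneg
    by (intro integrableI_nonneg) (auto simp: emeasure_density)
  \<comment> \<open>The smoothed inversion integrals see only the characteristic function, so
    \<open>p\<close> and the mixture share one sequence; both are continuous at \<open>y\<close>,
    and limits are unique.\<close>
  have p_eq: "p y = stable_mixture \<alpha> \<nu> y" if "y \<noteq> 0" for y
  proof -
    have "isCont p y"
      using p_cont that by (simp add: continuous_on_eq_continuous_at open_Compl)
    note lim_p = fourier_inversion_smoothed[OF p_int p_nonneg this]
    have "0 \<le> stable_mixture \<alpha> \<nu> z" for z :: "real ^ 'n"
      using \<alpha> Gamma_real_pos[OF \<nu>] stable_mixture_integrand_nonneg[OF mix]
      by (simp add: stable_mixture_def)
    note lim_mix = fourier_inversion_smoothed[OF integrable_stable_mixture[OF mix] this isCont_stable_mixture[OF mix e that]]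
    have "complex_of_real ((2 * pi) ^ DIM(real ^ 'n) * p y)
      = complex_of_real ((2 * pi) ^ DIM(real ^ 'n) * stable_mixture \<alpha> \<nu> y)"
      using lim_p lim_mix unfolding p_char density_char_stable_mixture[OF mix] by (rule LIMSEQ_unique)
    then show ?thesis
      unfolding of_real_eq_iff by simp
  qed
  have integrand: "stable_mixture_integrand \<alpha> \<nu> u x = indicator {0<..} u *\<^sub>R (u powr (\<alpha> * \<nu> - real CARD('n) - 1) * exp (- (u powr \<alpha>)) *
      radial_profile (stable_density \<alpha> :: real ^ 'n \<Rightarrow> real) (norm x / u))" for u
  proof (cases "0 < u")
    case True
    have "radial_profile (stable_density \<alpha> :: real ^ 'n \<Rightarrow> real) (norm (x /\<^sub>R u)) = stable_density \<alpha> (x /\<^sub>R u)"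
      by (intro radial_profile_eqI stable_density_radial \<alpha>)
    then show ?thesis
      using True by (simp add: stable_mixture_integrand_def divide_inverse mult.commute)
  qed (simp add: stable_mixture_integrand_def)
  have "integrable lborel (\<lambda>u. stable_mixture_integrand \<alpha> \<nu> u x)"
    using integrable_stable_mixture_integrand_iff[OF mix e \<open>x \<noteq> 0\<close>] integrable_dilated_integrand[OF mix e] \<open>x \<noteq> 0\<close>
    by simp
  \<comment> \<open>Radial symmetry of \<open>p\<close> is inherited from the mixture, which in its
    dilated form depends on the norm alone.\<close>
  moreover have "radial_profile p (norm x) = p x"
  proof (rule radial_profile_eqI)
    fix y :: "real ^ 'n" assume "norm y = norm x"
    moreover from this have "y \<noteq> 0" using \<open>x \<noteq> 0\<close> by auto
    ultimately show "p y = p x"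
      using \<open>x \<noteq> 0\<close> by (simp add: p_eq stable_mixture_eq_dilated[OF mix e])
  qed
  ultimately show ?thesis
    using p_eq[OF \<open>x \<noteq> 0\<close>] unfolding set_integrable_def set_lebesgue_integral_def integrand[symmetric] stable_mixture_def
    by simp
qed

end
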